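(* Let $\sigma>\rho>0$ be arbitrary fixed constants and put $\delta_i=i^{-(1+\sigma)}$, $\ell_i=i^{\rho}$ for $i=1,2,3,\ldots$. Let $a_1>0$ and $a_{i+1}=a_i+\ell_i$. Let $f:(0,\infty)\to(0,\infty)$ be right-continuous with $f(x)=\delta_i$ for $x\in[a_i,a_{i+1})$, $i=1,2,3,\ldots$, such that the domain $$\mathcal D=\{(x,y)\in\mathbb R^2: x>0,\ 0<y<f(x)\}$$ has piecewise smooth boundary and finite area. Let $\{\varphi_j\}_j$ be an orthonormal basis of $L^2(\mathcal D)$ of eigenfunctions of the Dirichlet Laplacian on $\mathcal D$, with eigenvalues $0<\lambda_1\le\lambda_2\le\cdots\to\infty$, and let $d\nu_j=|\varphi_j(x,y)|^2\,dx\,dy$. Then there is a constant $C>0$ such that at least one of the following two statements is true: (a) There is a subsequence of eigenfunctions $\varphi_{j_i}$ ($i=1,2,\ldots$) with eigenvalues $$\lambda_{j_i}\in\pi^2i^{2(1+\sigma)}+[-C\,i^{-2\rho},\,C\,i^{-2\rho}]$$ and some $c>0$ such that for any compact $\mathcal K\subset\mathcal D$ we have $$\liminf_{i\to\infty}\int_{\mathcal D-\mathcal K}d\nu_{j_i}>c.$$ (b) The number of eigenvalues $\lambda_j$ in the interval $\pi^2i^{2(1+\sigma)}+[-C\,i^{-2\rho},\,C\,i^{-2\rho}]$ is unbounded as $i\to\infty$.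
   Context: The Dirichlet eigenvalue problem is $(\Delta+\lambda)\varphi=0$ in $\mathcal D$, $\varphi|_{\partial\mathcal D}=0$, with $\Delta=\partial_x^2+\partial_y^2$. The spectrum is discrete. Eigenvalues are listed and counted with multiplicity. For $t\in\mathbb R$ and an interval $I$, $t+I=\{t+s:s\in I\}$. *)

theory Defs
  imports "HOL-Analysis.Analysis"
begin

definition subgraph_domain :: "(real \<Rightarrow> real) \<Rightarrow> (real \<times> real) set" where
  "subgraph_domain f = {(x, y). 0 < x \<and> 0 < y \<and> y < f x}"


text \<open>
  A boundary is piecewise smooth if it is a locally finite union of regular smooth arcs which
  meet only in common end points. Local finiteness (instead of finiteness) is needed because the
  domains are unbounded and may have infinitely many corners. Differentiability at the end points
  of an arc is one-sided.
\<close>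

definition smooth_arc :: "(real \<Rightarrow> real \<times> real) \<Rightarrow> bool" where
  "smooth_arc g \<longleftrightarrow> arc g \<and>
     (\<exists>G :: nat \<Rightarrow> real \<Rightarrow> real \<times> real. G 0 = g \<and>
        (\<forall>n. \<forall>t\<in>{0..1}. (G n has_vector_derivative G (Suc n) t) (at t within {0..1})) \<and>
        (\<forall>t\<in>{0..1}. G 1 t \<noteq> 0))"

definition piecewise_smooth_boundary :: "(real \<times> real) set \<Rightarrow> bool" where
  "piecewise_smooth_boundary D \<longleftrightarrow>
     (\<exists>A. (\<forall>g\<in>A. smooth_arc g) \<and>
          frontier D = (\<Union>g\<in>A. path_image g) \<and>
          (\<forall>K. compact K \<longrightarrow> finite {g \<in> A. path_image g \<inter> K \<noteq> {}}) \<and>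
          (\<forall>g\<in>A. \<forall>h\<in>A. g \<noteq> h \<longrightarrow>
             path_image g \<inter> path_image h \<subseteq>
               {pathstart g, pathfinish g} \<inter> {pathstart h, pathfinish h}))"


definition partial_x :: "(real \<times> real \<Rightarrow> 'a::real_normed_vector) \<Rightarrow> real \<times> real \<Rightarrow> 'a" where
  "partial_x u p = vector_derivative (\<lambda>t. u (t, snd p)) (at (fst p))"

definition partial_y :: "(real \<times> real \<Rightarrow> 'a::real_normed_vector) \<Rightarrow> real \<times> real \<Rightarrow> 'a" where
  "partial_y u p = vector_derivative (\<lambda>t. u (fst p, t)) (at (snd p))"

definition laplacian :: "(real \<times> real \<Rightarrow> 'a::real_normed_vector) \<Rightarrow> real \<times> real \<Rightarrow> 'a" where
  "laplacian u p = partial_x (partial_x u) p + partial_y (partial_y u) p"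

definition C1_on :: "(real \<times> real) set \<Rightarrow> (real \<times> real \<Rightarrow> 'a::real_normed_vector) \<Rightarrow> bool" where
  "C1_on D u \<longleftrightarrow>
     (\<forall>p\<in>D. (\<lambda>t. u (t, snd p)) differentiable (at (fst p)) \<and>
            (\<lambda>t. u (fst p, t)) differentiable (at (snd p))) \<and>
     continuous_on D (partial_x u) \<and> continuous_on D (partial_y u)"

definition C2_on :: "(real \<times> real) set \<Rightarrow> (real \<times> real \<Rightarrow> 'a::real_normed_vector) \<Rightarrow> bool" where
  "C2_on D u \<longleftrightarrow> C1_on D u \<and> C1_on D (partial_x u) \<and> C1_on D (partial_y u)"


definition L2_on :: "(real \<times> real) set \<Rightarrow> (real \<times> real \<Rightarrow> complex) \<Rightarrow> bool" where
  "L2_on D u \<longleftrightarrow> set_borel_measurable lborel D u \<and>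
                 set_integrable lborel D (\<lambda>p. (cmod (u p))\<^sup>2)"

definition L2_inner ::
    "(real \<times> real) set \<Rightarrow> (real \<times> real \<Rightarrow> complex) \<Rightarrow> (real \<times> real \<Rightarrow> complex) \<Rightarrow> complex" where
  "L2_inner D u v = (LINT p:D|lborel. u p * cnj (v p))"

definition L2_orthonormal_basis ::
    "(real \<times> real) set \<Rightarrow> (nat \<Rightarrow> real \<times> real \<Rightarrow> complex) \<Rightarrow> bool" where
  "L2_orthonormal_basis D \<phi> \<longleftrightarrow>
     (\<forall>j. L2_on D (\<phi> j)) \<and>
     (\<forall>j k. L2_inner D (\<phi> j) (\<phi> k) = (if j = k then 1 else 0)) \<and>
     (\<forall>u. L2_on D u \<longrightarrow>
        (\<lambda>n. LINT p:D|lborel. (cmod (u p - (\<Sum>j<n. L2_inner D u (\<phi> j) * \<phi> j p)))\<^sup>2)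
          \<longlonglongrightarrow> 0)"


text \<open>
  Eigenfunctions are classical: twice continuously differentiable inside, continuous up to the
  boundary and vanishing there. For open \<open>D\<close>, square integrability forces such functions into
  the Sobolev space \<open>H\<^sup>1\<^sub>0\<close> (a Caccioppoli estimate for \<open>(u - \<epsilon>)\<^sup>+\<close>), also when \<open>D\<close> is unbounded.
  Conversely, every \<open>H\<^sup>1\<^sub>0\<close>-eigenfunction has a representative of this form when each boundary
  point lies on a nondegenerate connected set in the complement, as holds for a subgraph domain.
\<close>

definition dirichlet_eigenfunction ::
    "(real \<times> real) set \<Rightarrow> real \<Rightarrow> (real \<times> real \<Rightarrow> complex) \<Rightarrow> bool" where
  "dirichlet_eigenfunction D \<mu> u \<longleftrightarrow>
     L2_on D u \<and> C2_on D u \<and> continuous_on (closure D) u \<and>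
     (\<forall>p\<in>D. laplacian u p + \<mu> *\<^sub>R u p = 0) \<and>
     (\<forall>p\<in>frontier D. u p = 0) \<and>
     (\<exists>p\<in>D. u p \<noteq> 0)"


definition spectral_window :: "real \<Rightarrow> real \<Rightarrow> real \<Rightarrow> nat \<Rightarrow> real set" where
  "spectral_window \<sigma> \<rho> C i =
     (+) (pi\<^sup>2 * real i powr (2 * (1 + \<sigma>))) `
       {- (C * real i powr (- 2 * \<rho>)) .. C * real i powr (- 2 * \<rho>)}"

end

(* A mode chi(x) sin(pi y / d) on a half of the i-th rectangle, with a bump chi vanishing to second
   order at both ends, satisfies the eigenvalue equation for (pi / d)^2 up to an error of relative
   L^2 size O(length^-2). Pairing it with the eigenfunctions (Green's formula) and using Parseval,
   three quarters of its mass lie on the eigenvalues in a window of that width. If the windows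
   contain boundedly many eigenvalues, one eigenfunction per window carries a fixed share of the
   mode, hence, by Cauchy-Schwarz, a fixed part of its own mass lies in a rectangle that leaves every
   compact set. The finitely many windows at the start, which may overlap, are handled by enlarging
   the constant and using the first eigenvalues there. *)

theory Submission
  imports Defs
begin

subsection \<open>Square-integrable functions\<close>

text \<open>Half of each rectangle is used because \<open>f\<close> drops at the right end: on the
  closed interval up to the midpoint it is constant, so the rectangle with closed vertical sides
  lies in \<open>D\<close>. The bump is a polynomial, so the relative error is explicit: its square
  is \<open>504\<close> over the fourth power of the length, that is 8064 over the fourth power of
  the full length, below \<open>8100 = 90^2\<close>. Doubling 90 to 180 makes the Chebyshev tail at
  most 1/4, whence the three quarters. Two obstacles shape the rest. Eigenfunctions are only
  continuous up to the boundary, so Green's formula cannot be applied directly on the rectangle. And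
  the selected indices have to increase strictly from the very first window on, so using up the
  first eigenvalues for the early windows requires that sufficiently many eigenvalues lie below the
  later ones. This comes from counting mass: the rectangles are disjoint, so one eigenfunction
  absorbs total weight at most 1 from all modes, and n modes of low energy force almost n low
  eigenvalues.\<close>

definition square_integrable :: "'a measure \<Rightarrow> ('a \<Rightarrow> complex) \<Rightarrow> bool" where
  "square_integrable M u \<longleftrightarrow> u \<in> borel_measurable M \<and> integrable M (\<lambda>x. (cmod (u x))\<^sup>2)"

lemma square_integrable_mult_cnj:
  assumes "square_integrable M u" "square_integrable M v"
  shows "integrable M (\<lambda>x. u x * cnj (v x))"
proof (rule Bochner_Integration.integrable_bound)
  show "integrable M (\<lambda>x. (cmod (u x))\<^sup>2 + (cmod (v x))\<^sup>2)"
    using assms by (simp add: square_integrable_def)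
  show "(\<lambda>x. u x * cnj (v x)) \<in> borel_measurable M"
    using assms unfolding square_integrable_def
    by (auto intro!: borel_measurable_times borel_measurable_continuous_onI continuous_intros
        measurable_compose[where g = cnj and N = borel])
  have "a * b \<le> a\<^sup>2 + b\<^sup>2" if "0 \<le> a" "0 \<le> b" for a b :: real
  proof -
    have "2 * (a * b) \<le> a\<^sup>2 + b\<^sup>2" using sum_squares_bound[of a b] by (simp add: mult.assoc)
    moreover have "0 \<le> a * b" using that by simp
    ultimately show ?thesis by linarith
  qed
  then show "AE x in M. norm (u x * cnj (v x)) \<le> norm ((cmod (u x))\<^sup>2 + (cmod (v x))\<^sup>2)"
    by (auto simp: norm_mult)
qed

lemma cmod_diff_scaled_squared:
  "(cmod (a - c * b))\<^sup>2 = (cmod a)\<^sup>2 - 2 * Re (cnj c * (a * cnj b)) + (cmod c)\<^sup>2 * (cmod b)\<^sup>2"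
  unfolding cmod_power2 by (simp add: power2_eq_square algebra_simps)

text \<open>Removing a single component is the one computation behind both Cauchy-Schwarz and the
  induction that yields the Bessel and Parseval statements.\<close>

lemma square_integrable_diff_scaled:
  assumes u: "square_integrable M u" and v: "square_integrable M v"
  shows "square_integrable M (\<lambda>x. u x - c * v x)"
    and "(LINT x|M. (cmod (u x - c * v x))\<^sup>2) =
      (LINT x|M. (cmod (u x))\<^sup>2) - 2 * Re (cnj c * (LINT x|M. u x * cnj (v x)))
      + (cmod c)\<^sup>2 * (LINT x|M. (cmod (v x))\<^sup>2)"
proof -
  have i: "integrable M (\<lambda>x. u x * cnj (v x))"
    by (rule square_integrable_mult_cnj[OF assms])
  then have i': "integrable M (\<lambda>x. cnj c * (u x * cnj (v x)))"
    by (rule integrable_mult_right)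
  have iu: "integrable M (\<lambda>x. (cmod (u x))\<^sup>2)" and iv: "integrable M (\<lambda>x. (cmod (v x))\<^sup>2)"
    using assms by (auto simp: square_integrable_def)
  show "square_integrable M (\<lambda>x. u x - c * v x)"
    using assms iu iv i' unfolding square_integrable_def cmod_diff_scaled_squared
    by (auto intro!: integrable_Re Bochner_Integration.integrable_add Bochner_Integration.integrable_diff
        integrable_mult_right simp del: times_complex.simps)
  show "(LINT x|M. (cmod (u x - c * v x))\<^sup>2) =
      (LINT x|M. (cmod (u x))\<^sup>2) - 2 * Re (cnj c * (LINT x|M. u x * cnj (v x)))
      + (cmod c)\<^sup>2 * (LINT x|M. (cmod (v x))\<^sup>2)"
  proof -
    have "(LINT x|M. (cmod (u x - c * v x))\<^sup>2)
        = (LINT x|M. (cmod (u x))\<^sup>2) - 2 * (LINT x|M. Re (cnj c * (u x * cnj (v x))))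
          + (cmod c)\<^sup>2 * (LINT x|M. (cmod (v x))\<^sup>2)"
      unfolding cmod_diff_scaled_squared using iu iv integrable_Re[OF i']
      by (simp del: times_complex.simps)
    also have "(LINT x|M. Re (cnj c * (u x * cnj (v x)))) = Re (cnj c * (LINT x|M. u x * cnj (v x)))"
      using integral_Re[OF i'] i by (simp del: times_complex.simps)
    finally show ?thesis .
  qed
qed

lemma cauchy_schwarz_cnj:
  assumes u: "square_integrable M u" and v: "square_integrable M v"
    and pos: "0 < (LINT x|M. (cmod (v x))\<^sup>2)"
  shows "(cmod (LINT x|M. u x * cnj (v x)))\<^sup>2
    \<le> (LINT x|M. (cmod (v x))\<^sup>2) * (LINT x|M. (cmod (u x))\<^sup>2)"
proof -
  define V where "V = (LINT x|M. (cmod (v x))\<^sup>2)"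
  define I where "I = (LINT x|M. u x * cnj (v x))"
  \<comment> \<open>The coefficient of the orthogonal projection of \<open>u\<close> onto
    \<open>v\<close>; it minimises the norm of \<open>u - c v\<close>, so nonnegativity of that norm
    is exactly Cauchy-Schwarz.\<close>
  define c where "c = I / complex_of_real V"
  have V: "0 < V" using pos by (simp add: V_def)
  have "0 \<le> (LINT x|M. (cmod (u x - c * v x))\<^sup>2)"
    by (rule integral_nonneg_AE) auto
  also have "\<dots> = (LINT x|M. (cmod (u x))\<^sup>2) - 2 * Re (cnj c * I) + (cmod c)\<^sup>2 * V"
    using square_integrable_diff_scaled(2)[OF u v, of c] by (simp add: V_def I_def)
  also have "cnj c * I = complex_of_real ((cmod I)\<^sup>2 / V)"
    using complex_norm_square[of I] by (simp add: c_def mult.commute)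
  also have "(cmod c)\<^sup>2 * V = (cmod I)\<^sup>2 / V"
    using V by (simp add: c_def norm_divide power_divide power2_eq_square)
  finally have "(cmod I)\<^sup>2 / V \<le> (LINT x|M. (cmod (u x))\<^sup>2)"
    by simp
  then show ?thesis
    using V by (simp add: field_simps flip: V_def I_def)
qed

text \<open>Pythagoras, with one component split off at a time. Nonnegativity of the left side gives
  Bessel; its convergence to 0 gives Parseval.\<close>

lemma orthonormal_residual:
  fixes \<phi> :: "nat \<Rightarrow> 'a \<Rightarrow> complex"
  assumes u: "square_integrable M u" and \<phi>: "\<And>j. square_integrable M (\<phi> j)"
    and on: "\<And>j k. (LINT x|M. \<phi> j x * cnj (\<phi> k x)) = (if j = k then 1 else 0 :: complex)"
  defines "c \<equiv> \<lambda>j. LINT x|M. u x * cnj (\<phi> j x)"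
  shows "(LINT x|M. (cmod (u x - (\<Sum>j<n. c j * \<phi> j x)))\<^sup>2)
      = (LINT x|M. (cmod (u x))\<^sup>2) - (\<Sum>j<n. (cmod (c j))\<^sup>2)"
proof -
  define r where "r n x = u x - (\<Sum>j<n. c j * \<phi> j x)" for n :: nat and x
  have rS: "r (Suc n) = (\<lambda>x. r n x - c n * \<phi> n x)" for n
    by (auto simp: r_def fun_eq_iff)
  have sq: "square_integrable M (r n)" for n
  proof (induction n)
    case 0
    then show ?case using u by (simp add: r_def)
  next
    case (Suc n)
    then show ?case unfolding rS by (rule square_integrable_diff_scaled(1)[OF _ \<phi>])
  qed
  \<comment> \<open>Invariant of the induction: the residual is orthogonal to the components already
    removed and keeps the original coefficients on the others.\<close>
  have inner: "(LINT x|M. r n x * cnj (\<phi> k x)) = c k - (if k < n then c k else 0)" for n k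
  proof (induction n)
    case 0
    then show ?case by (simp add: r_def c_def)
  next
    case (Suc n)
    have "(LINT x|M. r (Suc n) x * cnj (\<phi> k x))
        = (LINT x|M. r n x * cnj (\<phi> k x) - c n * (\<phi> n x * cnj (\<phi> k x)))"
      by (simp add: rS algebra_simps)
    also have "\<dots> = (LINT x|M. r n x * cnj (\<phi> k x)) - c n * (LINT x|M. \<phi> n x * cnj (\<phi> k x))"
      using square_integrable_mult_cnj[OF sq \<phi>] square_integrable_mult_cnj[OF \<phi> \<phi>] by simp
    finally show ?case using Suc on[of n k] by auto
  qed
  have unit: "(LINT x|M. (cmod (\<phi> j x))\<^sup>2) = 1" for j
  proof -
    have "complex_of_real (LINT x|M. (cmod (\<phi> j x))\<^sup>2) = (LINT x|M. \<phi> j x * cnj (\<phi> j x))"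
      by (simp only: integral_complex_of_real[symmetric] complex_norm_square)
    then show ?thesis using on[of j j] by (metis of_real_eq_1_iff)
  qed
  have "(LINT x|M. (cmod (r n x))\<^sup>2) = (LINT x|M. (cmod (u x))\<^sup>2) - (\<Sum>j<n. (cmod (c j))\<^sup>2)"
  proof (induction n)
    case 0
    then show ?case by (simp add: r_def)
  next
    case (Suc n)
    have "(LINT x|M. (cmod (r (Suc n) x))\<^sup>2)
        = (LINT x|M. (cmod (r n x))\<^sup>2) - 2 * Re (cnj (c n) * c n) + (cmod (c n))\<^sup>2"
      using square_integrable_diff_scaled(2)[OF sq \<phi>, of n "c n" n] inner[of n n] unit[of n]
      by (simp add: rS)
    also have "Re (cnj (c n) * c n) = (cmod (c n))\<^sup>2"
      unfolding cmod_power2 by (simp add: power2_eq_square)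
    finally show ?case using Suc by simp
  qed
  then show "(LINT x|M. (cmod (u x - (\<Sum>j<n. c j * \<phi> j x)))\<^sup>2)
      = (LINT x|M. (cmod (u x))\<^sup>2) - (\<Sum>j<n. (cmod (c j))\<^sup>2)"
    by (simp add: r_def)
qed

subsection \<open>Pairing eigenfunctions with modes on a rectangle\<close>

lemma C2_on_C1:
  assumes "C2_on D u"
  shows "C1_on D u" "C1_on D (partial_x u)" "C1_on D (partial_y u)"
  using assms by (auto simp: C2_on_def)

lemma C1_on_derivatives:
  assumes "C1_on D u" "(x, y) \<in> D"
  shows "((\<lambda>t. u (t, y)) has_vector_derivative partial_x u (x, y)) (at x)"
    and "((\<lambda>t. u (x, t)) has_vector_derivative partial_y u (x, y)) (at y)"
  using assms by (force simp: C1_on_def partial_x_def partial_y_def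
      simp flip: vector_derivative_works)+

text \<open>The integrand difference is the derivative of \<eta>' u - \<eta> u_x, whose end values
  vanish because \<eta> and \<eta>' do.\<close>

lemma green_segment_x:
  fixes u :: "real \<times> real \<Rightarrow> complex"
  assumes u: "C2_on D u" and D: "{p..q} \<times> {y} \<subseteq> D" and pq: "p \<le> q"
    and \<eta>: "\<And>x. (\<eta> has_real_derivative \<eta>' x) (at x)" "\<And>x. (\<eta>' has_real_derivative \<eta>'' x) (at x)"
    and \<eta>0: "\<eta> p = 0" "\<eta> q = 0" "\<eta>' p = 0" "\<eta>' q = 0"
    and \<eta>c: "continuous_on UNIV \<eta>''"
  shows "integral {p..q} (\<lambda>x. \<eta>'' x *\<^sub>R u (x, y))
    = integral {p..q} (\<lambda>x. \<eta> x *\<^sub>R partial_x (partial_x u) (x, y))"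
proof -
  have d1: "((\<lambda>t. u (t, y)) has_vector_derivative partial_x u (x, y)) (at x)" if "x \<in> {p..q}" for x
    by (rule C1_on_derivatives[OF C2_on_C1(1)[OF u]]) (use D that in auto)
  have d2: "((\<lambda>t. partial_x u (t, y)) has_vector_derivative partial_x (partial_x u) (x, y)) (at x)"
    if "x \<in> {p..q}" for x
    by (rule C1_on_derivatives[OF C2_on_C1(2)[OF u]]) (use D that in auto)
  have "((\<lambda>x. \<eta>'' x *\<^sub>R u (x, y) - \<eta> x *\<^sub>R partial_x (partial_x u) (x, y)) has_integral
      (\<eta>' q *\<^sub>R u (q, y) - \<eta> q *\<^sub>R partial_x u (q, y))
      - (\<eta>' p *\<^sub>R u (p, y) - \<eta> p *\<^sub>R partial_x u (p, y))) {p..q}"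
  proof (rule fundamental_theorem_of_calculus[OF pq])
    fix x assume x: "x \<in> {p..q}"
    show "((\<lambda>x. \<eta>' x *\<^sub>R u (x, y) - \<eta> x *\<^sub>R partial_x u (x, y)) has_vector_derivative
        \<eta>'' x *\<^sub>R u (x, y) - \<eta> x *\<^sub>R partial_x (partial_x u) (x, y)) (at x within {p..q})"
      by (rule has_vector_derivative_at_within)
        (auto intro!: derivative_eq_intros d1[OF x] d2[OF x] \<eta>)
  qed
  then have eq: "((\<lambda>x. \<eta>'' x *\<^sub>R u (x, y) - \<eta> x *\<^sub>R partial_x (partial_x u) (x, y)) has_integral 0) {p..q}"
    using \<eta>0 by simp
  have sec: "continuous_on {p..q} (\<lambda>x. v (x, y))" if "continuous_on D v" for v :: "real \<times> real \<Rightarrow> complex"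
    by (rule continuous_on_compose2[OF that]) (use D in \<open>auto intro!: continuous_intros\<close>)
  have c\<eta>: "continuous_on S \<eta>" for S
    by (rule DERIV_continuous_on, rule DERIV_subset[OF \<eta>(1)]) auto
  have cu: "continuous_on {p..q} (\<lambda>x. u (x, y))"
    by (rule continuous_on_vector_derivative) (rule has_vector_derivative_at_within[OF d1])
  have "(\<lambda>x. \<eta>'' x *\<^sub>R u (x, y)) integrable_on {p..q}"
    by (intro integrable_continuous_interval continuous_on_scaleR cu continuous_on_subset[OF \<eta>c]) simp
  moreover have "(\<lambda>x. \<eta> x *\<^sub>R partial_x (partial_x u) (x, y)) integrable_on {p..q}"
    using C2_on_C1(2)[OF u]
    by (intro integrable_continuous_interval continuous_on_scaleR c\<eta> sec) (auto simp: C1_on_def)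
  ultimately show ?thesis
    using integral_unique[OF eq] by (simp add: integral_diff)
qed

text \<open>\<open>Y\<close> contracts the closed segment into the open one, where \<open>u\<close>
  is twice differentiable; each derivative of the composition costs a factor \<open>r\<close>. The
  sine vanishes at both ends, which removes the terms with the derivative of \<open>u\<close>, and
  its slopes \<plusminus>\<open>pi / d\<close> there leave the sum of two values of
  \<open>u\<close>.\<close>

lemma green_segment_y:
  fixes u :: "real \<times> real \<Rightarrow> complex"
  assumes u: "C2_on D u" and D: "{x} \<times> {0<..<d} \<subseteq> D" and d: "0 < d" and r: "0 < r" "r < 1"
  defines "Y \<equiv> \<lambda>y. d / 2 + r * (y - d / 2)"
  shows "((\<lambda>y. sin (pi * y / d) *\<^sub>R
        (r\<^sup>2 *\<^sub>R partial_y (partial_y u) (x, Y y) + (pi / d)\<^sup>2 *\<^sub>R u (x, Y y)))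
      has_integral (pi / d) *\<^sub>R (u (x, Y 0) + u (x, Y d))) {0..d}"
proof -
  have Y: "Y y \<in> {0<..<d}" if "y \<in> {0..d}" for y
  proof -
    have "r * (d / 2) < d / 2" using r d by simp
    moreover have "\<bar>y - d / 2\<bar> \<le> d / 2"
      using that unfolding abs_le_iff by auto
    then have "\<bar>r * (y - d / 2)\<bar> \<le> r * (d / 2)"
      using r by (simp add: abs_mult)
    ultimately show ?thesis unfolding Y_def by auto
  qed
  have dY: "(Y has_real_derivative r) (at y)" for y
    unfolding Y_def by (auto intro!: derivative_eq_intros)
  have comp: "((\<lambda>y. v (x, Y y)) has_vector_derivative r *\<^sub>R partial_y v (x, Y y)) (at y)"
    if "C1_on D v" "y \<in> {0..d}" for v :: "real \<times> real \<Rightarrow> complex" and y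
  proof -
    have "(x, Y y) \<in> D" using D Y[OF that(2)] by auto
    from vector_diff_chain_at[OF dY[of y, unfolded has_real_derivative_iff_has_vector_derivative]
        C1_on_derivatives(2)[OF that(1) this]]
    show ?thesis by (simp add: o_def)
  qed
  define c where "c = pi / d"
  define s where "s y = sin (c * y)" for y
  define k where "k y = (c) * cos (c * y)" for y
  have dc: "((\<lambda>y. c * y) has_real_derivative c) (at y)" for y
    by (rule DERIV_cmult_Id)
  have ds: "(s has_real_derivative k y) (at y)" for y
    unfolding s_def k_def using DERIV_chain2[OF DERIV_sin dc, of y] by (simp add: mult.commute)
  have dk: "(k has_real_derivative - (c)\<^sup>2 * s y) (at y)" for y
    unfolding s_def k_def using DERIV_cmult[OF DERIV_chain2[OF DERIV_cos dc[of y]], of "c"]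
    by (simp add: power2_eq_square mult_ac)
  define W where "W y = (r * s y) *\<^sub>R partial_y u (x, Y y) - k y *\<^sub>R u (x, Y y)" for y
  have "((\<lambda>y. s y *\<^sub>R (r\<^sup>2 *\<^sub>R partial_y (partial_y u) (x, Y y) + (c)\<^sup>2 *\<^sub>R u (x, Y y)))
      has_integral W d - W 0) {0..d}"
  proof (rule fundamental_theorem_of_calculus)
    show "0 \<le> d" using d by simp
    fix y assume y: "y \<in> {0..d}"
    have "(W has_vector_derivative
        ((r * s y) *\<^sub>R (r *\<^sub>R partial_y (partial_y u) (x, Y y)) + (r * k y) *\<^sub>R partial_y u (x, Y y))
        - (k y *\<^sub>R (r *\<^sub>R partial_y u (x, Y y)) + (- (c)\<^sup>2 * s y) *\<^sub>R u (x, Y y))) (at y)"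
      unfolding W_def
      by (rule has_vector_derivative_diff
          [OF has_vector_derivative_scaleR[OF DERIV_cmult[OF ds] comp[OF C2_on_C1(3)[OF u] y]]
            has_vector_derivative_scaleR[OF dk comp[OF C2_on_C1(1)[OF u] y]]])
    moreover have "((r * a) *\<^sub>R (r *\<^sub>R A) + (r * b) *\<^sub>R P) - (b *\<^sub>R (r *\<^sub>R P) + (- c\<^sup>2 * a) *\<^sub>R U)
        = a *\<^sub>R (r\<^sup>2 *\<^sub>R A + c\<^sup>2 *\<^sub>R U)" for a b :: real and A P U :: complex
      by (simp add: scaleR_conv_of_real power2_eq_square algebra_simps)
    ultimately show "(W has_vector_derivative
        s y *\<^sub>R (r\<^sup>2 *\<^sub>R partial_y (partial_y u) (x, Y y) + c\<^sup>2 *\<^sub>R u (x, Y y)))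
        (at y within {0..d})"
      by (simp only: has_vector_derivative_at_within)
  qed
  moreover have "W d - W 0 = (c) *\<^sub>R (u (x, Y 0) + u (x, Y d))"
    using d by (simp add: W_def s_def k_def c_def scaleR_add_right)
  ultimately show ?thesis by (simp add: s_def flip: c_def) (simp add: c_def)
qed

lemma integral_box_iterated:
  fixes f :: "real \<times> real \<Rightarrow> complex"
  assumes "continuous_on (cbox (a, c) (b, d)) f"
  shows "integral (cbox (a, c) (b, d)) f = integral {a..b} (\<lambda>x. integral {c..d} (\<lambda>y. f (x, y)))"
    and "integral (cbox (a, c) (b, d)) f = integral {c..d} (\<lambda>y. integral {a..b} (\<lambda>x. f (x, y)))"
  using integral_prod_continuous[OF assms] integral_swap_continuous[of a c b d "\<lambda>x y. f (x, y)"] assms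
  by (auto simp: case_prod_beta)

text \<open>Symmetry of the Laplacian: applying \<Delta> + (\<open>pi / d\<close>)^2 to the mode
  leaves only \<eta>'' times the sine, while moving the operator onto \<open>u\<close> gives the
  factor (\<open>pi / d\<close>)^2 - \<mu>. So the coefficients of the error term are those of the
  mode times the distance in energy.\<close>

lemma eigenfunction_mode_pairing:
  fixes u :: "real \<times> real \<Rightarrow> complex"
  assumes u: "C2_on D u" and D: "{p..q} \<times> {0<..<d} \<subseteq> D" and pq: "p \<le> q" and d: "0 < d"
    and cont: "continuous_on (cbox (p, 0) (q, d)) u"
    and eig: "\<And>z. z \<in> D \<Longrightarrow> laplacian u z + \<mu> *\<^sub>R u z = 0"
    and bdry: "\<And>x. x \<in> {p..q} \<Longrightarrow> u (x, 0) = 0 \<and> u (x, d) = 0"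
    and \<eta>: "\<And>x. (\<eta> has_real_derivative \<eta>' x) (at x)" "\<And>x. (\<eta>' has_real_derivative \<eta>'' x) (at x)"
    and \<eta>0: "\<eta> p = 0" "\<eta> q = 0" "\<eta>' p = 0" "\<eta>' q = 0"
    and \<eta>c: "continuous_on UNIV \<eta>''"
  shows "integral (cbox (p, 0) (q, d)) (\<lambda>z. (\<eta>'' (fst z) * sin (pi * snd z / d)) *\<^sub>R u z)
    = ((pi / d)\<^sup>2 - \<mu>) *\<^sub>R
      integral (cbox (p, 0) (q, d)) (\<lambda>z. (\<eta> (fst z) * sin (pi * snd z / d)) *\<^sub>R u z)"
proof -
  \<comment> \<open>The derivatives of \<open>u\<close> need not extend to the edges \<open>y = 0\<close> and \<open>y = d\<close>. Green's formula
    is therefore applied to \<open>u\<close> on the strip contracted by a factor \<open>r < 1\<close>, where only boundary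
    values of \<open>u\<close> itself appear, and then \<open>r \<longlonglongrightarrow> 1\<close>.\<close>
  define Y where "Y r y = d / 2 + r * (y - d / 2)" for r y :: real
  define s where "s y = sin (pi * y / d)" for y :: real
  define Z where "Z r z = (fst z, Y r (snd z))" for r and z :: "real \<times> real"
  let ?Q = "cbox (p, 0) (q, d)"
  have Ycl: "Y r y \<in> {0..d}" if "y \<in> {0..d}" "r \<in> {0..1}" for r y
  proof -
    have "\<bar>y - d / 2\<bar> \<le> d / 2"
      using that(1) unfolding abs_le_iff by auto
    then have "\<bar>r * (y - d / 2)\<bar> \<le> 1 * (d / 2)"
      unfolding abs_mult using that d by (intro mult_mono) auto
    then show ?thesis unfolding Y_def by auto
  qed
  have Yop: "Y r y \<in> {0<..<d}" if "y \<in> {0..d}" "r \<in> {0<..<1}" for r y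
  proof -
    have "\<bar>y - d / 2\<bar> \<le> d / 2"
      using that(1) unfolding abs_le_iff by auto
    then have "\<bar>r * (y - d / 2)\<bar> \<le> r * (d / 2)"
      unfolding abs_mult using that d by (intro mult_mono) auto
    moreover have "r * (d / 2) < d / 2" using that d by simp
    ultimately show ?thesis unfolding Y_def by auto
  qed
  have c\<eta>: "continuous_on S \<eta>" for S
    by (rule DERIV_continuous_on, rule DERIV_subset[OF \<eta>(1)]) auto
  have c\<eta>'': "continuous_on S \<eta>''" for S
    by (rule continuous_on_subset[OF \<eta>c]) simp
  have cs: "continuous_on S s" for S
    unfolding s_def using d by (auto intro!: continuous_intros)
  define I where "I \<psi> r = integral ?Q (\<lambda>z. (\<psi> (fst z) * s (snd z)) *\<^sub>R u (Z r z))" for \<psi> r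
  define B where "B r = integral {p..q} (\<lambda>x. \<eta> x *\<^sub>R (pi / d) *\<^sub>R (u (x, Y r 0) + u (x, Y r d)))" for r
  \<comment> \<open>Only continuity of \<open>u\<close> on the closed rectangle enters here, so the
    pairing is continuous in \<open>r\<close> up to and including \<open>r = 1\<close>.\<close>
  have contI: "continuous_on {0..1} (I \<psi>)" if "\<And>S. continuous_on S \<psi>" for \<psi>
    unfolding I_def
  proof (rule integral_continuous_on_param)
    have "continuous_on ({0..1} \<times> ?Q) (\<lambda>w. u (Z (fst w) (snd w)))"
      by (rule continuous_on_compose2[OF cont])
        (use Ycl in \<open>auto intro!: continuous_intros simp: Z_def Y_def cbox_Pair_eq\<close>)
    then show "continuous_on ({0..1} \<times> ?Q) (\<lambda>(r, z). (\<psi> (fst z) * s (snd z)) *\<^sub>R u (Z r z))"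
      unfolding case_prod_beta
      by (intro continuous_on_scaleR continuous_on_mult continuous_on_compose2[OF that[of UNIV]]
          continuous_on_compose2[OF cs[of UNIV]]) (auto intro!: continuous_intros)
  qed
  have contB: "continuous_on {0..1} B"
    unfolding B_def interval_cbox[of p q]
  proof (rule integral_continuous_on_param)
    have "continuous_on ({0..1} \<times> {p..q}) (\<lambda>w. u (snd w, Y (fst w) y))" if "y \<in> {0..d}" for y
      by (rule continuous_on_compose2[OF cont])
        (use Ycl that in \<open>auto intro!: continuous_intros simp: Y_def cbox_Pair_eq\<close>)
    from this[of 0] this[of d] show "continuous_on ({0..1} \<times> cbox p q)
        (\<lambda>(r, x). \<eta> x *\<^sub>R (pi / d) *\<^sub>R (u (x, Y r 0) + u (x, Y r d)))"
      unfolding case_prod_beta cbox_interval using d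
      by (intro continuous_on_scaleR continuous_on_add continuous_on_const
          continuous_on_compose2[OF c\<eta>[of UNIV]] continuous_on_snd continuous_on_id) auto
  qed
  have ident: "r\<^sup>2 *\<^sub>R I \<eta>'' r + (\<mu> * r\<^sup>2 - (pi / d)\<^sup>2) *\<^sub>R I \<eta> r + B r = 0" if r: "r \<in> {0<..<1}" for r
  proof -
    have ZD: "Z r z \<in> D" if "z \<in> ?Q" for z
      using that D Yop[OF _ r] by (force simp: Z_def cbox_Pair_eq)
    have contZ: "continuous_on ?Q (\<lambda>z. v (Z r z))" if "continuous_on D v" for v :: "real \<times> real \<Rightarrow> complex"
      by (rule continuous_on_compose2[OF that])
        (use ZD in \<open>auto intro!: continuous_intros simp: Z_def Y_def\<close>)
    have contuZ: "continuous_on ?Q (\<lambda>z. u (Z r z))"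
      by (rule continuous_on_compose2[OF cont])
        (use Ycl r in \<open>auto intro!: continuous_intros simp: Z_def Y_def cbox_Pair_eq\<close>)
    let ?xx = "partial_x (partial_x u)" and ?yy = "partial_y (partial_y u)"
    have cxx: "continuous_on ?Q (\<lambda>z. ?xx (Z r z))" and cyy: "continuous_on ?Q (\<lambda>z. ?yy (Z r z))"
      using C2_on_C1[OF u] by (auto intro!: contZ simp: C1_on_def)
    have cmix: "continuous_on ?Q (\<lambda>z. r\<^sup>2 *\<^sub>R ?yy (Z r z) + (pi / d)\<^sup>2 *\<^sub>R u (Z r z))"
      by (intro continuous_on_add continuous_on_scaleR continuous_on_const cyy contuZ)
    have mult: "continuous_on ?Q (\<lambda>z. (\<psi> (fst z) * s (snd z)) *\<^sub>R g z)"
      if "\<And>S. continuous_on S \<psi>" "continuous_on ?Q g" for \<psi> :: "real \<Rightarrow> real" and g :: "real \<times> real \<Rightarrow> complex"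
      by (intro continuous_on_scaleR continuous_on_mult continuous_on_compose2[OF that(1)[of UNIV]]
          continuous_on_compose2[OF cs[of UNIV]] that) (auto intro!: continuous_intros)
    have "I \<eta>'' r = integral {0..d} (\<lambda>y. integral {p..q} (\<lambda>x. (\<eta>'' x * s y) *\<^sub>R u (x, Y r y)))"
      unfolding I_def by (subst integral_box_iterated(2)[OF mult[OF c\<eta>'' contuZ]]) (simp add: Z_def)
    also have "\<dots> = integral {0..d} (\<lambda>y. integral {p..q} (\<lambda>x. (\<eta> x * s y) *\<^sub>R ?xx (x, Y r y)))"
    proof (rule integral_cong)
      fix y assume y: "y \<in> {0..d}"
      have "{p..q} \<times> {Y r y} \<subseteq> D" using D Yop[OF y r] by auto
      note g = green_segment_x[OF u this pq \<eta> \<eta>0 \<eta>c]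
      have "integral {p..q} (\<lambda>x. s y *\<^sub>R \<eta>'' x *\<^sub>R u (x, Y r y))
          = integral {p..q} (\<lambda>x. s y *\<^sub>R \<eta> x *\<^sub>R ?xx (x, Y r y))"
        unfolding integral_cmul g ..
      then show "integral {p..q} (\<lambda>x. (\<eta>'' x * s y) *\<^sub>R u (x, Y r y))
          = integral {p..q} (\<lambda>x. (\<eta> x * s y) *\<^sub>R ?xx (x, Y r y))"
        by (simp add: mult.commute)
    qed
    also have "\<dots> = integral ?Q (\<lambda>z. (\<eta> (fst z) * s (snd z)) *\<^sub>R ?xx (Z r z))"
      by (subst integral_box_iterated(2)[OF mult[OF c\<eta> cxx]]) (simp add: Z_def)
    finally have X: "I \<eta>'' r = integral ?Q (\<lambda>z. (\<eta> (fst z) * s (snd z)) *\<^sub>R ?xx (Z r z))" .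
    have "integral ?Q (\<lambda>z. (\<eta> (fst z) * s (snd z)) *\<^sub>R (r\<^sup>2 *\<^sub>R ?yy (Z r z) + (pi / d)\<^sup>2 *\<^sub>R u (Z r z)))
        = integral {p..q} (\<lambda>x. integral {0..d} (\<lambda>y. \<eta> x *\<^sub>R s y *\<^sub>R
            (r\<^sup>2 *\<^sub>R ?yy (x, Y r y) + (pi / d)\<^sup>2 *\<^sub>R u (x, Y r y))))"
      by (subst integral_box_iterated(1)[OF mult[OF c\<eta> cmix]]) (simp add: Z_def)
    also have "\<dots> = B r"
      unfolding B_def
    proof (rule integral_cong)
      fix x assume x: "x \<in> {p..q}"
      have "{x} \<times> {0<..<d} \<subseteq> D" using D x by auto
      note g = integral_unique[OF green_segment_y[OF u this d, of r]]
      show "integral {0..d} (\<lambda>y. \<eta> x *\<^sub>R s y *\<^sub>R (r\<^sup>2 *\<^sub>R ?yy (x, Y r y) + (pi / d)\<^sup>2 *\<^sub>R u (x, Y r y)))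
          = \<eta> x *\<^sub>R (pi / d) *\<^sub>R (u (x, Y r 0) + u (x, Y r d))"
        using g r unfolding integral_cmul by (simp add: s_def Y_def)
    qed
    finally have BY: "B r = integral ?Q (\<lambda>z. (\<eta> (fst z) * s (snd z)) *\<^sub>R (r\<^sup>2 *\<^sub>R ?yy (Z r z) + (pi / d)\<^sup>2 *\<^sub>R u (Z r z)))" ..
    \<comment> \<open>Weighting the identity in x by \<open>r^2\<close> matches the factor that
      contraction puts on the second y-derivative. The two derivatives then add up to the Laplacian
      at the contracted point, where the eigenvalue equation holds.\<close>
    have "r\<^sup>2 *\<^sub>R I \<eta>'' r + B r
        = integral ?Q (\<lambda>z. r\<^sup>2 *\<^sub>R ((\<eta> (fst z) * s (snd z)) *\<^sub>R ?xx (Z r z))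
          + (\<eta> (fst z) * s (snd z)) *\<^sub>R (r\<^sup>2 *\<^sub>R ?yy (Z r z) + (pi / d)\<^sup>2 *\<^sub>R u (Z r z)))"
      unfolding X BY integral_cmul[symmetric]
      by (rule integral_add[symmetric])
        (intro integrable_continuous continuous_on_scaleR[OF continuous_on_const] mult c\<eta> cxx cmix)+
    also have "\<dots> = integral ?Q (\<lambda>z. ((pi / d)\<^sup>2 - \<mu> * r\<^sup>2) *\<^sub>R ((\<eta> (fst z) * s (snd z)) *\<^sub>R u (Z r z)))"
    proof (rule integral_cong)
      fix z assume "z \<in> ?Q"
      from eig[OF ZD[OF this]] have xx: "?xx (Z r z) = - (\<mu> *\<^sub>R u (Z r z)) - ?yy (Z r z)"
        by (simp add: laplacian_def eq_neg_iff_add_eq_0 eq_diff_eq)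
      show "r\<^sup>2 *\<^sub>R ((\<eta> (fst z) * s (snd z)) *\<^sub>R ?xx (Z r z))
          + (\<eta> (fst z) * s (snd z)) *\<^sub>R (r\<^sup>2 *\<^sub>R ?yy (Z r z) + (pi / d)\<^sup>2 *\<^sub>R u (Z r z))
        = ((pi / d)\<^sup>2 - \<mu> * r\<^sup>2) *\<^sub>R ((\<eta> (fst z) * s (snd z)) *\<^sub>R u (Z r z))"
        unfolding xx by (simp add: algebra_simps)
    qed
    also have "\<dots> = ((pi / d)\<^sup>2 - \<mu> * r\<^sup>2) *\<^sub>R I \<eta> r"
      unfolding integral_cmul I_def ..
    finally show ?thesis by (simp add: algebra_simps)
  qed
  have cE: "continuous_on {0..1} (\<lambda>r. r\<^sup>2 *\<^sub>R I \<eta>'' r + (\<mu> * r\<^sup>2 - (pi / d)\<^sup>2) *\<^sub>R I \<eta> r + B r)"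
    by (intro continuous_intros contI contB c\<eta> c\<eta>'')
  have "1\<^sup>2 *\<^sub>R I \<eta>'' 1 + (\<mu> * 1\<^sup>2 - (pi / d)\<^sup>2) *\<^sub>R I \<eta> 1 + B 1 = 0"
    by (rule continuous_constant_on_closure[of "{0<..<1::real}"
          "\<lambda>r. r\<^sup>2 *\<^sub>R I \<eta>'' r + (\<mu> * r\<^sup>2 - (pi / d)\<^sup>2) *\<^sub>R I \<eta> r + B r"]) (use cE ident in auto)
  moreover have "B 1 = 0"
    unfolding B_def Y_def using bdry by (intro integral_unique has_integral_is_0) auto
  ultimately have "I \<eta>'' 1 = ((pi / d)\<^sup>2 - \<mu>) *\<^sub>R I \<eta> 1"
    by (simp add: algebra_simps)
  then show ?thesis
    by (simp add: I_def Z_def Y_def s_def)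
qed

subsection \<open>Quasimodes\<close>

text \<open>The polynomial of least degree with double zeros at both ends, which is what the
  boundary terms of Green's formula require; its norms are explicit.\<close>

definition bump :: "real \<Rightarrow> real \<Rightarrow> real \<Rightarrow> real" where
  "bump p q x = (x - p)\<^sup>2 * (q - x)\<^sup>2"

definition bump' :: "real \<Rightarrow> real \<Rightarrow> real \<Rightarrow> real" where
  "bump' p q x = 2 * (x - p) * (q - x) * (p + q - 2 * x)"

definition bump'' :: "real \<Rightarrow> real \<Rightarrow> real \<Rightarrow> real" where
  "bump'' p q x = 2 * (q - x)\<^sup>2 - 8 * (x - p) * (q - x) + 2 * (x - p)\<^sup>2"

lemma DERIV_bump: "(bump p q has_real_derivative bump' p q x) (at x)"
  unfolding bump_def[abs_def] bump'_def
  by (auto intro!: derivative_eq_intros) (simp add: algebra_simps power2_eq_square)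

lemma DERIV_bump': "(bump' p q has_real_derivative bump'' p q x) (at x)"
  unfolding bump'_def[abs_def] bump''_def
  by (auto intro!: derivative_eq_intros) (simp add: algebra_simps power2_eq_square)

text \<open>After rescaling this is the Beta integral B(5,5) = 4! 4! / 9! = 1/630.\<close>

lemma integral_bump_squared:
  assumes "p \<le> q"
  shows "integral {p..q} (\<lambda>x. (bump p q x)\<^sup>2) = (q - p) ^ 9 / 630"
proof -
  define l where "l = q - p"
  define F where "F z = l ^ 4 * z ^ 5 / 5 - 2 * l ^ 3 * z ^ 6 / 3 + 6 * l\<^sup>2 * z ^ 7 / 7 - l * z ^ 8 / 2 + z ^ 9 / 9" for z
  have "((\<lambda>x. (bump p q x)\<^sup>2) has_integral F (q - p) - F (p - p)) {p..q}"
  proof (rule fundamental_theorem_of_calculus[OF assms])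
    fix x
    have dF: "(F has_real_derivative z ^ 4 * (l - z) ^ 4) (at z)" for z
      unfolding F_def by (auto intro!: derivative_eq_intros simp: eval_nat_numeral algebra_simps)
    have "((\<lambda>x. F (x - p)) has_real_derivative (x - p) ^ 4 * (l - (x - p)) ^ 4 * 1) (at x)"
      by (rule DERIV_chain2[OF dF]) (auto intro!: derivative_eq_intros)
    moreover have "(x - p) ^ 4 * (l - (x - p)) ^ 4 * 1 = (bump p q x)\<^sup>2"
      by (simp add: bump_def l_def power_mult_distrib flip: power_mult)
    ultimately show "((\<lambda>x. F (x - p)) has_vector_derivative (bump p q x)\<^sup>2) (at x within {p..q})"
      by (metis has_real_derivative_iff_has_vector_derivative has_vector_derivative_at_within)
  qed
  moreover have "F (q - p) - F (p - p) = l ^ 9 / 630"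
    by (simp add: F_def eval_nat_numeral flip: l_def)
  ultimately show ?thesis
    by (simp add: integral_unique l_def)
qed

text \<open>With l = q - p and t = (x - p) / l, \<open>bump''\<close> is 2 l^2 (1 - 6 t + 6 t^2), a
  multiple of the shifted Legendre polynomial of degree 2, whose square has integral 1/5 over the
  unit interval.\<close>

lemma integral_bump''_squared:
  assumes "p \<le> q"
  shows "integral {p..q} (\<lambda>x. (bump'' p q x)\<^sup>2) = 4 / 5 * (q - p) ^ 5"
proof -
  define l where "l = q - p"
  define F where "F z = 4 * l ^ 4 * z - 24 * l ^ 3 * z\<^sup>2 + 64 * l\<^sup>2 * z ^ 3 - 72 * l * z ^ 4 + 144 / 5 * z ^ 5" for z
  have "((\<lambda>x. (bump'' p q x)\<^sup>2) has_integral F (q - p) - F (p - p)) {p..q}"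
  proof (rule fundamental_theorem_of_calculus[OF assms])
    fix x
    have dF: "(F has_real_derivative (2 * l\<^sup>2 - 12 * l * z + 12 * z\<^sup>2)\<^sup>2) (at z)" for z
      unfolding F_def by (auto intro!: derivative_eq_intros simp: eval_nat_numeral algebra_simps)
    have "((\<lambda>x. F (x - p)) has_real_derivative (2 * l\<^sup>2 - 12 * l * (x - p) + 12 * (x - p)\<^sup>2)\<^sup>2 * 1) (at x)"
      by (rule DERIV_chain2[OF dF]) (auto intro!: derivative_eq_intros)
    moreover have "2 * l\<^sup>2 - 12 * l * (x - p) + 12 * (x - p)\<^sup>2 = bump'' p q x"
      by (simp add: bump''_def l_def power2_eq_square algebra_simps)
    ultimately show "((\<lambda>x. F (x - p)) has_vector_derivative (bump'' p q x)\<^sup>2) (at x within {p..q})"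
      by (metis mult.right_neutral has_real_derivative_iff_has_vector_derivative has_vector_derivative_at_within)
  qed
  moreover have "F (q - p) - F (p - p) = 4 / 5 * l ^ 5"
    by (simp add: F_def eval_nat_numeral flip: l_def)
  ultimately show ?thesis
    by (simp add: integral_unique l_def)
qed

lemma integral_sin_squared_half_period:
  assumes "0 < d"
  shows "integral {0..d} (\<lambda>y. (sin (pi * y / d))\<^sup>2) = d / 2"
proof -
  define c where "c = pi / d"
  have c: "c \<noteq> 0" using assms by (simp add: c_def)
  define F where "F y = y / 2 - sin (2 * (c * y)) / (4 * c)" for y
  have "((\<lambda>y. (sin (c * y))\<^sup>2) has_integral F d - F 0) {0..d}"
  proof (rule fundamental_theorem_of_calculus)
    show "0 \<le> d" using assms by simp
    fix y
    have "(F has_real_derivative 1 / 2 - cos (2 * (c * y)) * (2 * c) / (4 * c)) (at y)"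
      unfolding F_def by (auto intro!: derivative_eq_intros)
    moreover have "1 / 2 - cos (2 * (c * y)) * (2 * c) / (4 * c) = (sin (c * y))\<^sup>2"
      using c cos_double_sin[of "c * y"] by (simp add: field_simps)
    ultimately show "(F has_vector_derivative (sin (c * y))\<^sup>2) (at y within {0..d})"
      by (metis has_real_derivative_iff_has_vector_derivative has_vector_derivative_at_within)
  qed
  moreover have "F d - F 0 = d / 2"
    using assms by (simp add: F_def c_def)
  ultimately show ?thesis
    by (simp add: integral_unique c_def)
qed

lemma integral_box_mode_squared:
  fixes \<psi> :: "real \<Rightarrow> real"
  assumes d: "0 < d" and \<psi>: "continuous_on UNIV \<psi>"
  shows "integral (cbox (p, 0) (q, d)) (\<lambda>z. (\<psi> (fst z) * sin (pi * snd z / d))\<^sup>2)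
    = integral {p..q} (\<lambda>x. (\<psi> x)\<^sup>2) * (d / 2)"
proof -
  have "continuous_on (cbox (p, 0) (q, d)) (\<lambda>z. (\<psi> (fst z) * sin (pi * snd z / d))\<^sup>2)"
    using d by (intro continuous_intros continuous_on_compose2[OF \<psi>]) auto
  then have "integral (cbox (p, 0) (q, d)) (\<lambda>z. (\<psi> (fst z) * sin (pi * snd z / d))\<^sup>2)
      = integral {p..q} (\<lambda>x. integral {0..d} (\<lambda>y. (\<psi> x)\<^sup>2 * (sin (pi * y / d))\<^sup>2))"
    by (subst integral_prod_continuous) (simp_all only: power_mult_distrib cbox_interval fst_conv snd_conv)
  then show ?thesis
    using integral_sin_squared_half_period[OF d] by (simp only: integral_mult_right integral_mult_left)
qed


section \<open>Spectral weights of a quasimode\<close>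

lemma square_integrable_restrict_space_iff:
  assumes "D \<in> sets borel"
  shows "square_integrable (restrict_space lborel D) u \<longleftrightarrow> L2_on D u"
  using assms by (simp add: square_integrable_def L2_on_def set_borel_measurable_def set_integrable_def
      borel_measurable_restrict_space_iff integrable_restrict_space)

lemma set_lebesgue_integral_eq_restrict_space:
  fixes u :: "real \<times> real \<Rightarrow> 'b::{banach, second_countable_topology}"
  assumes "D \<in> sets borel"
  shows "(LINT p:D|lborel. u p) = (LINT p|restrict_space lborel D. u p)"
  using assms by (simp add: set_lebesgue_integral_def integral_restrict_space)

text \<open>\<open>w\<close> is the spectral measure of the normalised mode. Its total mass is 1 by
  Parseval, its second moment about (\<open>pi / d\<close>)^2 is bounded by Bessel for the error
  term, and the local bound is Cauchy-Schwarz on the rectangle that carries the mode. The constant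
  is (4/5) / (1/630) = 504.\<close>

lemma quasimode_spectral_weights:
  assumes D: "open D" and basis: "L2_orthonormal_basis D \<phi>"
    and eig: "\<And>j. dirichlet_eigenfunction D (lam j) (\<phi> j)"
    and pq: "p < q" and d: "0 < d"
    and BD: "{p..q} \<times> {0<..<d} \<subseteq> D"
    and edge: "\<And>x. x \<in> {p..q} \<Longrightarrow> (x, 0) \<notin> D \<and> (x, d) \<notin> D"
  obtains w :: "nat \<Rightarrow> real" where "\<And>j. 0 \<le> w j" "w sums 1"
    "\<And>j. w j \<le> (LINT z:{p..q} \<times> {0<..<d}|lborel. (cmod (\<phi> j z))\<^sup>2)"
    "\<And>n. (\<Sum>j<n. (lam j - (pi / d)\<^sup>2)\<^sup>2 * w j) \<le> 504 / (q - p) ^ 4"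
proof -
  define M where "M = restrict_space lborel D"
  define Q where "Q = cbox (p, 0) (q, d)"
  define B where "B = {p..q} \<times> {0<..<d}"
  define g where "g \<psi> z = \<psi> (fst z) * sin (pi * snd z / d)" for \<psi> and z :: "real \<times> real"
  define m where "m \<psi> z = indicator Q z *\<^sub>R complex_of_real (g \<psi> z)" for \<psi> z
  define I where "I \<psi> j = integral Q (\<lambda>z. g \<psi> z *\<^sub>R \<phi> j z)" for \<psi> j
  have Db: "D \<in> sets borel" using D by simp
  have Qeq: "Q = {p..q} \<times> {0..d}" unfolding Q_def cbox_Pair_eq by (simp only: cbox_interval)
  have Bb: "B \<in> sets borel"
  proof -
    have "B = Q \<inter> {z. 0 < snd z \<and> snd z < d}" by (auto simp: B_def Qeq)
    moreover have "open {z :: real \<times> real. 0 < snd z \<and> snd z < d}"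
      by (intro open_Collect_conj open_Collect_less continuous_intros)
    ultimately show ?thesis by (simp add: Q_def borel_closed sets.Int)
  qed
  have QcD: "Q \<subseteq> closure D"
  proof -
    have "Q = closure B" using d pq by (simp add: Qeq B_def closure_Times)
    then show ?thesis using BD by (auto simp: B_def intro: closure_mono[THEN subsetD])
  qed
  have edge0: "g \<psi> z = 0" if "z \<in> Q" "z \<notin> B" for \<psi> z
  proof -
    have "snd z = 0 \<or> snd z = d" using that by (auto simp: Qeq B_def)
    then show ?thesis using d by (auto simp: g_def)
  qed
  \<comment> \<open>The mode lives on the closed rectangle \<open>Q\<close>, where compactness gives
    integrability, but the horizontal edges of \<open>Q\<close> lie outside \<open>D\<close>. As the
    sine vanishes on them, restricting to \<open>D\<close> changes nothing.\<close>
  have indD: "indicator D z *\<^sub>R indicator Q z *\<^sub>R h = indicator Q z *\<^sub>R h"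
    if "z \<in> Q \<Longrightarrow> z \<notin> B \<Longrightarrow> h = 0" for z and h :: "'b::real_vector"
    using that BD by (auto simp: indicator_def B_def)
  have gc: "continuous_on S (g \<psi>)" if "continuous_on UNIV \<psi>" for \<psi> S
    unfolding g_def using d by (intro continuous_intros continuous_on_compose2[OF that]) auto
  have m2: "(cmod (m \<psi> z))\<^sup>2 = indicator Q z *\<^sub>R (g \<psi> z)\<^sup>2" for \<psi> z
    by (simp add: m_def indicator_def)
  have int_m2: "integrable lborel (\<lambda>z. indicator Q z *\<^sub>R (g \<psi> z)\<^sup>2)" if "continuous_on UNIV \<psi>" for \<psi>
    unfolding Q_def by (intro borel_integrable_compact compact_cbox continuous_intros gc that)
  have sqm: "square_integrable M (m \<psi>)" if "continuous_on UNIV \<psi>" for \<psi>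
  proof -
    have "m \<psi> \<in> borel_measurable lborel"
    proof -
      have "(\<lambda>z. complex_of_real (g \<psi> z)) \<in> borel_measurable borel"
        by (intro borel_measurable_continuous_onI continuous_intros gc that)
      then show ?thesis
        unfolding m_def by (intro borel_measurable_scaleR borel_measurable_indicator) (simp_all add: Q_def)
    qed
    moreover have "integrable M (\<lambda>z. (cmod (m \<psi> z))\<^sup>2)"
      unfolding m2 M_def using integrable_mult_indicator[OF _ int_m2[OF that], of D] Db
      by (simp add: integrable_restrict_space)
    ultimately show ?thesis
      by (simp add: square_integrable_def M_def measurable_restrict_space1)
  qed
  have norm_m: "(LINT z|M. (cmod (m \<psi> z))\<^sup>2) = integral {p..q} (\<lambda>x. (\<psi> x)\<^sup>2) * (d / 2)"
    if c: "continuous_on UNIV \<psi>" for \<psi>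
  proof -
    have "(LINT z|M. (cmod (m \<psi> z))\<^sup>2) = (LINT z|lborel. indicator D z *\<^sub>R indicator Q z *\<^sub>R (g \<psi> z)\<^sup>2)"
      unfolding m2 M_def using Db by (simp add: integral_restrict_space)
    also have "\<dots> = (LINT z:Q|lborel. (g \<psi> z)\<^sup>2)"
      unfolding set_lebesgue_integral_def by (intro Bochner_Integration.integral_cong refl indD) (simp add: edge0)
    also have "\<dots> = integral Q (\<lambda>z. (g \<psi> z)\<^sup>2)"
      by (rule set_borel_integral_eq_integral) (simp only: set_integrable_def int_m2[OF c])
    also have "\<dots> = integral {p..q} (\<lambda>x. (\<psi> x)\<^sup>2) * (d / 2)"
      unfolding Q_def g_def by (rule integral_box_mode_squared[OF d c])
    finally show ?thesis .
  qed
  have L2\<phi>: "square_integrable M (\<phi> j)" for j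
    using basis Db by (simp add: M_def square_integrable_restrict_space_iff L2_orthonormal_basis_def)
  have inner: "L2_inner D u v = (LINT z|M. u z * cnj (v z))" for u v
    using Db by (simp add: L2_inner_def M_def set_lebesgue_integral_eq_restrict_space)
  have on: "(LINT z|M. \<phi> j z * cnj (\<phi> k z)) = (if j = k then 1 else 0)" for j k
    using basis inner by (simp add: L2_orthonormal_basis_def)
  have \<phi>c: "continuous_on Q (\<phi> j)" for j
    using eig[of j] QcD continuous_on_subset by (auto simp: dirichlet_eigenfunction_def)
  \<comment> \<open>\<open>I\<close> pairs the real mode with the eigenfunction itself, as Green's
    formula does, whereas the inner product conjugates it; hence the conjugate.\<close>
  have pair: "(LINT z|M. m \<psi> z * cnj (\<phi> j z)) = cnj (I \<psi> j)" if c: "continuous_on UNIV \<psi>" for \<psi> j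
  proof -
    have "(LINT z|M. m \<psi> z * cnj (\<phi> j z))
        = (LINT z|lborel. indicator D z *\<^sub>R indicator Q z *\<^sub>R (g \<psi> z *\<^sub>R cnj (\<phi> j z)))"
      unfolding m_def M_def using Db
      by (simp add: integral_restrict_space scaleR_conv_of_real mult.assoc)
    also have "\<dots> = (LINT z:Q|lborel. g \<psi> z *\<^sub>R cnj (\<phi> j z))"
      unfolding set_lebesgue_integral_def by (intro Bochner_Integration.integral_cong refl indD) (simp add: edge0)
    also have "\<dots> = integral Q (\<lambda>z. g \<psi> z *\<^sub>R cnj (\<phi> j z))"
      by (rule set_borel_integral_eq_integral)
        (unfold set_integrable_def Q_def, intro borel_integrable_compact compact_cbox continuous_intros
          gc c \<phi>c[unfolded Q_def])
    also have "\<dots> = cnj (I \<psi> j)"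
      by (simp add: I_def integral_cnj)
    finally show ?thesis .
  qed
  have cb: "continuous_on UNIV (bump p q)" and cb'': "continuous_on UNIV (bump'' p q)"
    unfolding bump_def[abs_def] bump''_def[abs_def] by (intro continuous_intros)+
  have green: "I (bump'' p q) j = ((pi / d)\<^sup>2 - lam j) *\<^sub>R I (bump p q) j" for j
    unfolding I_def g_def Q_def
  proof (rule eigenfunction_mode_pairing[OF _ BD _ d _ _ _ DERIV_bump DERIV_bump' _ _ _ _ cb''])
    \<comment> \<open>Horizontal edge points belong to the closure of \<open>D\<close> but not to
      \<open>D\<close>, so the Dirichlet condition applies there.\<close>
    have fr: "z \<in> frontier D" if "z \<in> Q" "z \<notin> D" for z
      using that QcD D by (auto simp: frontier_def interior_open)
    show "\<phi> j (x, 0) = 0 \<and> \<phi> j (x, d) = 0" if "x \<in> {p..q}" for x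
      using eig[of j] edge[OF that] that d fr[of "(x, 0)"] fr[of "(x, d)"]
      by (auto simp: dirichlet_eigenfunction_def Qeq)
  qed (use eig[of j] pq \<phi>c[of j] in
      \<open>auto simp: dirichlet_eigenfunction_def Q_def bump_def bump'_def\<close>)
  define U where "U = (q - p) ^ 9 / 630 * (d / 2)"
  define V where "V = 4 / 5 * (q - p) ^ 5 * (d / 2)"
  have U: "(LINT z|M. (cmod (m (bump p q) z))\<^sup>2) = U"
    using pq by (simp add: norm_m[OF cb] integral_bump_squared U_def)
  have V: "(LINT z|M. (cmod (m (bump'' p q) z))\<^sup>2) = V"
    using pq by (simp add: norm_m[OF cb''] integral_bump''_squared V_def)
  have U0: "0 < U" using pq d by (simp add: U_def)
  have VU: "V / U = 504 / (q - p) ^ 4"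
  proof -
    have "(q - p) ^ 9 = (q - p) ^ 4 * (q - p) ^ 5" by (simp flip: power_add)
    then show ?thesis using pq d by (simp add: U_def V_def field_simps)
  qed
  define w where "w j = (cmod (I (bump p q) j))\<^sup>2 / U" for j
  show thesis
  proof (rule that)
    show "0 \<le> w j" for j using U0 by (simp add: w_def)
    \<comment> \<open>Completeness of the basis enters here: the residual of the mode tends to 0, so
      its weights sum to exactly 1.\<close>
    have "(\<lambda>n. LINT z|M. (cmod (m (bump p q) z - (\<Sum>j<n. cnj (I (bump p q) j) * \<phi> j z)))\<^sup>2) \<longlonglongrightarrow> 0"
    proof -
      have "L2_on D (m (bump p q))"
        using sqm[OF cb] Db by (simp add: M_def square_integrable_restrict_space_iff)
      then have "(\<lambda>n. LINT z:D|lborel. (cmod (m (bump p q) z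
          - (\<Sum>j<n. L2_inner D (m (bump p q)) (\<phi> j) * \<phi> j z)))\<^sup>2) \<longlonglongrightarrow> 0"
        using basis by (simp only: L2_orthonormal_basis_def)
      then show ?thesis
        by (simp add: inner pair[OF cb] M_def[symmetric] set_lebesgue_integral_eq_restrict_space[OF Db])
    qed
    then have "(\<lambda>n. U - (\<Sum>j<n. (cmod (I (bump p q) j))\<^sup>2)) \<longlonglongrightarrow> 0"
      using orthonormal_residual[OF sqm[OF cb] L2\<phi> on] by (simp add: pair[OF cb] U)
    from tendsto_diff[OF tendsto_const[of U] this]
    have "(\<lambda>j. (cmod (I (bump p q) j))\<^sup>2) sums U"
      by (simp add: sums_def)
    from sums_divide[OF this, of U] show "w sums 1"
      using U0 by (simp add: w_def[abs_def])
    show "(\<Sum>j<n. (lam j - (pi / d)\<^sup>2)\<^sup>2 * w j) \<le> 504 / (q - p) ^ 4" for n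
    proof -
      \<comment> \<open>For the error term Bessel's inequality is enough; Green's formula then
        rewrites its coefficients in terms of those of the mode.\<close>
      have "0 \<le> V - (\<Sum>j<n. (cmod (I (bump'' p q) j))\<^sup>2)"
        using orthonormal_residual[OF sqm[OF cb''] L2\<phi> on, of n, symmetric]
        by (simp add: pair[OF cb''] V)
      then have "(\<Sum>j<n. (cmod (I (bump'' p q) j))\<^sup>2) / U \<le> V / U"
        using U0 by (simp add: divide_right_mono)
      also have "(\<Sum>j<n. (cmod (I (bump'' p q) j))\<^sup>2) / U = (\<Sum>j<n. (lam j - (pi / d)\<^sup>2)\<^sup>2 * w j)"
        by (simp add: green w_def power_mult_distrib sum_divide_distrib power2_commute[of "lam _"])
      finally show ?thesis by (simp add: VU)
    qed
    show "w j \<le> (LINT z:{p..q} \<times> {0<..<d}|lborel. (cmod (\<phi> j z))\<^sup>2)" for j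
    proof -
      \<comment> \<open>Cutting the eigenfunction off to the rectangle does not change its pairing
        with the mode, but replaces its full norm in Cauchy-Schwarz by its local mass.\<close>
      let ?f = "\<lambda>z. indicator B z *\<^sub>R \<phi> j z"
      have BM: "B \<in> sets M"
        using Bb BD Db by (auto simp: M_def sets_restrict_space_iff B_def)
      have f2: "(cmod (?f z))\<^sup>2 = indicator B z *\<^sub>R (cmod (\<phi> j z))\<^sup>2" for z
        by (simp add: indicator_def)
      have sqf: "square_integrable M ?f"
        using L2\<phi>[of j] BM unfolding square_integrable_def f2
        by (intro conjI integrable_mult_indicator borel_measurable_scaleR borel_measurable_indicator) auto
      have "(LINT z|M. ?f z * cnj (m (bump p q) z)) = (LINT z|M. cnj (m (bump p q) z * cnj (\<phi> j z)))"
        by (intro Bochner_Integration.integral_cong) (auto simp: m_def indicator_def edge0)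
      also have "\<dots> = I (bump p q) j"
        unfolding Bochner_Integration.integral_cnj pair[OF cb] by simp
      finally have "(cmod (I (bump p q) j))\<^sup>2 \<le> U * (LINT z|M. (cmod (?f z))\<^sup>2)"
        using cauchy_schwarz_cnj[OF sqf sqm[OF cb]] U0 by (simp add: U)
      also have "(LINT z|M. (cmod (?f z))\<^sup>2) = (LINT z:B|lborel. (cmod (\<phi> j z))\<^sup>2)"
      proof -
        have "(LINT z|M. (cmod (?f z))\<^sup>2)
            = (LINT z|lborel. indicator D z *\<^sub>R indicator B z *\<^sub>R (cmod (\<phi> j z))\<^sup>2)"
          unfolding f2 M_def using Db by (simp add: integral_restrict_space)
        also have "\<dots> = (LINT z:B|lborel. (cmod (\<phi> j z))\<^sup>2)"
          unfolding set_lebesgue_integral_def using BD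
          by (intro Bochner_Integration.integral_cong) (auto simp: indicator_def B_def)
        finally show ?thesis .
      qed
      finally show ?thesis
        using U0 by (simp add: w_def B_def field_simps)
    qed
  qed
qed

subsection \<open>Selecting eigenvalues\<close>

text \<open>Chebyshev's inequality for the probability weights \<open>w\<close> on the eigenvalues,
  with \<open>e\<close> bounding the second moment about \<mu>.\<close>

lemma spectral_mass_ge:
  fixes w lam :: "nat \<Rightarrow> real"
  assumes w: "\<And>j. 0 \<le> w j" "w sums 1"
    and e: "\<And>n. (\<Sum>j<n. (lam j - \<mu>)\<^sup>2 * w j) \<le> e"
    and J: "finite J" and g: "0 < g" "\<And>j. j \<notin> J \<Longrightarrow> g \<le> \<bar>lam j - \<mu>\<bar>"
  shows "1 - e / g\<^sup>2 \<le> (\<Sum>j\<in>J. w j)"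
proof -
  have bound: "(\<Sum>j<n. w j) \<le> (\<Sum>j\<in>J. w j) + e / g\<^sup>2" for n
  proof -
    have "(\<Sum>j\<in>{..<n} - J. w j) \<le> (\<Sum>j\<in>{..<n} - J. (lam j - \<mu>)\<^sup>2 * w j / g\<^sup>2)"
    proof (rule sum_mono)
      fix j assume j: "j \<in> {..<n} - J"
      have "g\<^sup>2 \<le> (lam j - \<mu>)\<^sup>2"
        using g j power_mono[of g "\<bar>lam j - \<mu>\<bar>" 2] by simp
      then have "g\<^sup>2 * w j \<le> (lam j - \<mu>)\<^sup>2 * w j"
        by (intro mult_right_mono w)
      then show "w j \<le> (lam j - \<mu>)\<^sup>2 * w j / g\<^sup>2"
        using g by (simp add: field_simps)
    qed
    also have "\<dots> \<le> (\<Sum>j<n. (lam j - \<mu>)\<^sup>2 * w j / g\<^sup>2)"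
      using w by (intro sum_mono2) auto
    also have "\<dots> \<le> e / g\<^sup>2"
      using e[of n] by (simp add: divide_right_mono flip: sum_divide_distrib)
    finally have "(\<Sum>j\<in>{..<n} - J. w j) \<le> e / g\<^sup>2" .
    moreover have "(\<Sum>j\<in>{..<n} \<inter> J. w j) \<le> (\<Sum>j\<in>J. w j)"
      using w J by (intro sum_mono2) auto
    moreover have "(\<Sum>j<n. w j) = (\<Sum>j\<in>{..<n} \<inter> J. w j) + (\<Sum>j\<in>{..<n} - J. w j)"
      by (rule sum.Int_Diff) auto
    ultimately show ?thesis by linarith
  qed
  have "(\<lambda>n. \<Sum>j<n. w j) \<longlonglongrightarrow> 1"
    using w(2) by (simp add: sums_def)
  then have "1 \<le> (\<Sum>j\<in>J. w j) + e / g\<^sup>2"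
    by (rule LIMSEQ_le_const2) (use bound in auto)
  then show ?thesis by linarith
qed

text \<open>The combinatorial core, separated from the analysis: \<open>w i j\<close> is the weight
  of mode \<open>i\<close> on eigenfunction \<open>j\<close>. The bound \<open>cap\<close> expresses
  that the modes have disjoint supports; it forces enough eigenvalues below the later windows to
  keep the chosen indices increasing.\<close>

lemma quasimode_selection:
  fixes lam \<mu> \<epsilon> :: "nat \<Rightarrow> real" and w :: "nat \<Rightarrow> nat \<Rightarrow> real" and N :: nat
  assumes lam: "mono lam" "filterlim lam at_top sequentially"
    and w0: "\<And>i j. 1 \<le> i \<Longrightarrow> 0 \<le> w i j" and w1: "\<And>i. 1 \<le> i \<Longrightarrow> w i sums 1"
    and var: "\<And>i n. 1 \<le> i \<Longrightarrow> (\<Sum>j<n. (lam j - \<mu> i)\<^sup>2 * w i j) \<le> 8100 * (\<epsilon> i)\<^sup>2"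
    and cap: "\<And>j n. (\<Sum>i=1..n. w i j) \<le> 1"
    and \<epsilon>: "\<And>i. 1 \<le> i \<Longrightarrow> 0 < \<epsilon> i" "\<And>i. 1 \<le> i \<Longrightarrow> \<epsilon> i \<le> 1"
    and gap: "\<And>i. 1 \<le> i \<Longrightarrow> \<mu> i + 18 * real i \<le> \<mu> (Suc i)"
    and count: "\<And>i. i0 \<le> i \<Longrightarrow> card {j. \<bar>lam j - \<mu> i\<bar> \<le> 180 * \<epsilon> i} \<le> N"
  obtains C j c i1 where "C > 0" "strict_mono_on {1..} j"
    "\<And>i. 1 \<le> i \<Longrightarrow> \<bar>lam (j i) - \<mu> i\<bar> \<le> C * \<epsilon> i"
    "c > 0" "\<And>i. i1 \<le> i \<Longrightarrow> c \<le> w i (j i)"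
proof -
  define J where "J i = {j. \<bar>lam j - \<mu> i\<bar> \<le> 180 * \<epsilon> i}" for i
  have fin: "finite {j. lam j \<le> c}" for c
  proof -
    have "\<forall>\<^sub>F j in sequentially. c < lam j"
      using lam(2) by (simp add: filterlim_at_top_dense)
    then obtain m where "\<And>j. m \<le> j \<Longrightarrow> c < lam j"
      by (auto simp: eventually_sequentially)
    then have "{j. lam j \<le> c} \<subseteq> {..<m}" by (force simp: not_le[symmetric])
    then show ?thesis by (rule finite_subset) simp
  qed
  have finJ: "finite (J i)" for i
    by (rule finite_subset[OF _ fin[of "\<mu> i + 180 * \<epsilon> i"]]) (auto simp: J_def)
  have mass: "3 / 4 \<le> (\<Sum>j\<in>J i. w i j)" if i: "1 \<le> i" for i
  proof -
    have "1 - 8100 * (\<epsilon> i)\<^sup>2 / (180 * \<epsilon> i)\<^sup>2 \<le> (\<Sum>j\<in>J i. w i j)"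
      by (rule spectral_mass_ge[OF w0[OF i] w1[OF i] var[OF i] finJ]) (use \<epsilon>[OF i] in \<open>auto simp: J_def\<close>)
    moreover have "8100 * (\<epsilon> i)\<^sup>2 / (180 * \<epsilon> i)\<^sup>2 = 1 / 4"
      using \<epsilon>[OF i] by (simp add: power_mult_distrib)
    ultimately show ?thesis by linarith
  qed
  have cardJ: "0 < card (J i)" if "1 \<le> i" for i
    using mass[OF that] finJ[of i] by (auto simp: card_gt_0_iff)
  have N: "0 < N"
    using cardJ[of "max 1 i0"] count[of "max 1 i0"] by (simp add: J_def)
  \<comment> \<open>Pigeonhole: at most \<open>N\<close> indices share a mass of at least
    3/4.\<close>
  define c where "c = 3 / (4 * real N)"
  \<comment> \<open>Beyond 8200 the windows are far apart, since 18 (n - 1) > 360, and n - 1 tails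
    of size at most 8100 / n^2 add up to less than 1.\<close>
  define i1 where "i1 = max i0 8200"
  have "\<exists>k\<in>J i. c \<le> w i k" if i: "i1 \<le> i" for i
  proof (rule ccontr)
    assume "\<not> ?thesis"
    then have "(\<Sum>j\<in>J i. w i j) < real (card (J i)) * c"
      using i by (intro sum_bounded_above_strict cardJ) (auto simp: i1_def)
    also have "\<dots> \<le> real N * c"
      using count[of i] i by (intro mult_right_mono) (auto simp: J_def i1_def c_def)
    also have "\<dots> = 3 / 4" using N by (simp add: c_def)
    finally show False using mass[of i] i by (simp add: i1_def)
  qed
  then obtain k where k: "\<And>i. i1 \<le> i \<Longrightarrow> k i \<in> J i" "\<And>i. i1 \<le> i \<Longrightarrow> c \<le> w i (k i)"
    by metis
  have \<mu>gap: "\<mu> i + 18 * (real n - 1) \<le> \<mu> n" if "1 \<le> i" "i < n" for i n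
  proof -
    \<comment> \<open>The gap hypothesis starts at index 1, so monotonicity is stated for the
      shifted sequence.\<close>
    have "\<mu> (Suc m) \<le> \<mu> (Suc (Suc m))" for m
      using gap[of "Suc m"] by simp
    then have "incseq (\<lambda>m. \<mu> (Suc m))" by (rule incseq_SucI)
    from incseqD[OF this, of "i - 1" "n - 2"] that have "\<mu> i \<le> \<mu> (n - 1)" by (simp add: Suc_diff_Suc numeral_2_eq_2)
    moreover have "1 \<le> n - 1" using that by simp
    ultimately show ?thesis using gap[of "n - 1"] that by (simp add: of_nat_diff)
  qed
  have lamk: "lam (k i) \<le> \<mu> i + 180" "\<mu> i - 180 \<le> lam (k i)" if "i1 \<le> i" for i
    using k(1)[OF that] \<epsilon>(2)[of i] that by (auto simp: J_def i1_def)
  have kmono: "k i < k n" if "i1 \<le> i" "i < n" for i n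
  proof (rule ccontr)
    assume "\<not> k i < k n"
    then have "lam (k n) \<le> lam (k i)" using lam(1) by (auto intro: monoD)
    moreover have "\<mu> i + 18 * (real n - 1) \<le> \<mu> n" "8200 \<le> real n"
      using \<mu>gap[of i n] that by (auto simp: i1_def)
    moreover have "\<mu> n - 180 \<le> lam (k n)" using that by (intro lamk(2)) simp
    ultimately show False using lamk(1)[OF that(1)] by argo
  qed
  \<comment> \<open>Each of the modes \<open>1, ..., n - 1\<close> has almost all of its mass on the eigenvalues in
    \<open>K\<close>, and each eigenfunction absorbs mass at most 1 altogether.\<close>
  have k1: "i1 \<le> Suc (k i1)"
  proof -
    define n where "n = i1"
    define K where "K = {j. lam j < \<mu> n - 180}"
    have n: "8200 \<le> real n" by (simp add: n_def i1_def)
    have K: "finite K" by (rule finite_subset[OF _ fin[of "\<mu> n"]]) (auto simp: K_def)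
    \<comment> \<open>Eigenvalues outside \<open>K\<close> are at least \<mu> n - 180, hence at
      distance at least 18 (n - 1) - 180 \<ge> n from \<mu> i.\<close>
    have "1 - 8100 / (real n)\<^sup>2 \<le> (\<Sum>j\<in>K. w i j)" if i: "i \<in> {1..n - 1}" for i
    proof -
      from i have i1: "1 \<le> i" and "i < n" by auto
      have g: "\<mu> i + 18 * (real n - 1) \<le> \<mu> n" by (rule \<mu>gap[OF i1 \<open>i < n\<close>])
      have "1 - 8100 * (\<epsilon> i)\<^sup>2 / (real n)\<^sup>2 \<le> (\<Sum>j\<in>K. w i j)"
        by (rule spectral_mass_ge[OF w0[OF i1] w1[OF i1] var[OF i1] K]) (use n g in \<open>auto simp: K_def\<close>)
      moreover have "(\<epsilon> i)\<^sup>2 \<le> 1" using \<epsilon>[OF i1] by (simp add: power_le_one)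
      then have "8100 * (\<epsilon> i)\<^sup>2 / (real n)\<^sup>2 \<le> 8100 / (real n)\<^sup>2"
        by (intro divide_right_mono) auto
      ultimately show ?thesis by linarith
    qed
    then have "(\<Sum>i=1..n - 1. 1 - 8100 / (real n)\<^sup>2) \<le> (\<Sum>i=1..n - 1. \<Sum>j\<in>K. w i j)"
      by (rule sum_mono)
    also have "\<dots> = (\<Sum>j\<in>K. \<Sum>i=1..n - 1. w i j)" by (rule sum.swap)
    also have "\<dots> \<le> (\<Sum>j\<in>K. 1)" by (intro sum_mono cap)
    finally have "(real n - 1) * (1 - 8100 / (real n)\<^sup>2) \<le> real (card K)"
      using n by (simp add: of_nat_diff)
    moreover have "(real n - 1) * (8100 / (real n)\<^sup>2) < 1"
    proof -
      have "(real n - 1) * 8100 \<le> (real n - 1) * real n" using n by (intro mult_left_mono) auto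
      also have "\<dots> < real n * real n" using n by (intro mult_strict_right_mono) auto
      finally show ?thesis using n by (simp add: power2_eq_square)
    qed
    \<comment> \<open>The total mass on \<open>K\<close> exceeds n - 2, so \<open>K\<close> has at
      least n - 1 elements; all of them have an index below that of the eigenvalue chosen for window
      n.\<close>
    ultimately have "real n - 2 < real (card K)" by (simp add: right_diff_distrib)
    then have "n \<le> Suc (card K)" by linarith
    also have "card K \<le> k n"
    proof -
      have "K \<subseteq> {..<k n}"
      proof
        fix j assume "j \<in> K"
        then have "lam j < lam (k n)" using lamk(2)[of n] by (auto simp: K_def n_def)
        then show "j \<in> {..<k n}" using lam(1) by (auto simp: mono_def not_le[symmetric])
      qed
      then show ?thesis using card_mono[of "{..<k n}" K] by simp
    qed
    finally show ?thesis by (simp add: n_def)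
  qed
  \<comment> \<open>Eigenvalues are numbered from 0 and windows from 1, so the early windows receive
    the indices 0 to \<open>i1 - 2\<close>; \<open>k1\<close> says that \<open>k i1\<close> lies
    beyond these.\<close>
  define j where "j i = (if i < i1 then i - 1 else k i)" for i
  \<comment> \<open>Each early window contributes the factor by which it has to be widened to reach
    the eigenvalue assigned to it.\<close>
  define C where "C = 180 + (\<Sum>i=1..<i1. \<bar>lam (i - 1) - \<mu> i\<bar> / \<epsilon> i)"
  have sum0: "0 \<le> (\<Sum>i=1..<i1. \<bar>lam (i - 1) - \<mu> i\<bar> / \<epsilon> i)"
    using \<epsilon> by (intro sum_nonneg divide_nonneg_nonneg) (auto intro: less_imp_le)
  show thesis
  proof (rule that)
    show "C > 0" using sum0 by (simp add: C_def)
    show "c > 0" using N by (simp add: c_def)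
    show "c \<le> w i (j i)" if "i1 \<le> i" for i using k(2)[OF that] that by (simp add: j_def)
    show "strict_mono_on {1..} j"
    proof (rule strict_mono_onI)
      fix r s :: nat assume rs: "r \<in> {1..}" "s \<in> {1..}" "r < s"
      have "k i1 \<le> k s" if "i1 \<le> s" using kmono[of i1 s] that by (cases "i1 = s") auto
      then show "j r < j s" using rs kmono[of r s] k1 by (auto simp: j_def)
    qed
    show "\<bar>lam (j i) - \<mu> i\<bar> \<le> C * \<epsilon> i" if i: "1 \<le> i" for i
    proof (cases "i < i1")
      case True
      have "\<bar>lam (i - 1) - \<mu> i\<bar> / \<epsilon> i \<le> (\<Sum>i=1..<i1. \<bar>lam (i - 1) - \<mu> i\<bar> / \<epsilon> i)"
        using True i \<epsilon> by (intro member_le_sum) (auto intro!: divide_nonneg_nonneg less_imp_le[OF \<epsilon>(1)])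
      then have "\<bar>lam (i - 1) - \<mu> i\<bar> / \<epsilon> i \<le> C" by (simp add: C_def)
      then show ?thesis using True \<epsilon>(1)[OF i] by (simp add: j_def pos_divide_le_eq)
    next
      case False
      then have "\<bar>lam (j i) - \<mu> i\<bar> \<le> 180 * \<epsilon> i" using k(1)[of i] by (simp add: j_def J_def)
      also have "\<dots> \<le> C * \<epsilon> i"
        using sum0 \<epsilon>(1)[OF i] by (intro mult_right_mono) (auto simp: C_def)
      finally show ?thesis .
    qed
  qed
qed

subsection \<open>Concentration of eigenfunctions\<close>

lemma set_integral_mono_nonneg:
  fixes f :: "'a \<Rightarrow> real"
  assumes "set_integrable M A f" "B \<in> sets M" "B \<subseteq> A" "\<And>x. 0 \<le> f x"
  shows "(LINT x:B|M. f x) \<le> (LINT x:A|M. f x)"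
  using assms(1) set_integrable_subset[OF assms(1-3)] assms(3,4)
  unfolding set_lebesgue_integral_def set_integrable_def
  by (intro integral_mono) (auto simp: indicator_def)

lemma L2_orthonormal_basis_unit:
  assumes "L2_orthonormal_basis D \<phi>"
  shows "(LINT p:D|lborel. (cmod (\<phi> j p))\<^sup>2) = 1"
proof -
  have "complex_of_real (LINT p:D|lborel. (cmod (\<phi> j p))\<^sup>2) = L2_inner D (\<phi> j) (\<phi> j)"
    by (simp only: L2_inner_def set_integral_complex_of_real[symmetric] complex_norm_square)
  also have "\<dots> = 1" using assms by (simp add: L2_orthonormal_basis_def)
  finally show ?thesis by (metis of_real_eq_1_iff)
qed

text \<open>Split off the square: its increment exceeds 2 i, and the remaining factor with exponent
  2 \<sigma> is increasing and at least 1. This spaces the energies of the modes.\<close>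

lemma powr_Suc_gap:
  assumes "1 \<le> i" "0 < \<sigma>"
  shows "real i powr (2 * (1 + \<sigma>)) + 2 * real i \<le> real (Suc i) powr (2 * (1 + \<sigma>))"
proof -
  have split: "real k powr (2 * (1 + \<sigma>)) = (real k)\<^sup>2 * real k powr (2 * \<sigma>)" if "1 \<le> k" for k
    using that by (simp add: distrib_left powr_add)
  have "real i powr (2 * \<sigma>) \<le> real (Suc i) powr (2 * \<sigma>)"
    using assms by (intro powr_mono2) auto
  then have "(real (Suc i))\<^sup>2 * real i powr (2 * \<sigma>) \<le> (real (Suc i))\<^sup>2 * real (Suc i) powr (2 * \<sigma>)"
    by (intro mult_left_mono) auto
  moreover have "(real (Suc i))\<^sup>2 = (real i)\<^sup>2 + (2 * real i + 1)"
    by (simp add: power2_eq_square algebra_simps)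
  then have "(real (Suc i))\<^sup>2 * real i powr (2 * \<sigma>)
      = (real i)\<^sup>2 * real i powr (2 * \<sigma>) + (2 * real i + 1) * real i powr (2 * \<sigma>)"
    by (simp add: distrib_right)
  moreover have "(2 * real i + 1) * 1 \<le> (2 * real i + 1) * real i powr (2 * \<sigma>)"
    using assms by (intro mult_left_mono ge_one_powr_ge_zero) auto
  moreover have "real (Suc i) powr (2 * (1 + \<sigma>)) = (real (Suc i))\<^sup>2 * real (Suc i) powr (2 * \<sigma>)"
    by (rule split) simp
  ultimately show ?thesis
    unfolding split[OF assms(1)] by argo
qed

lemma mem_spectral_window_iff:
  "x \<in> spectral_window \<sigma> \<rho> C i \<longleftrightarrow>
    \<bar>x - pi\<^sup>2 * real i powr (2 * (1 + \<sigma>))\<bar> \<le> C * real i powr (- 2 * \<rho>)"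
proof -
  define m where "m = pi\<^sup>2 * real i powr (2 * (1 + \<sigma>))"
  define e where "e = C * real i powr (- 2 * \<rho>)"
  have "x \<in> (+) m ` {- e..e} \<longleftrightarrow> x - m \<in> {- e..e}"
    by (auto intro!: image_eqI[of _ _ "x - m"])
  then show ?thesis
    by (auto simp: spectral_window_def abs_le_iff simp flip: m_def e_def)
qed

theorem mainTheorem3:
  fixes \<sigma> \<rho> :: real
    and a :: "nat \<Rightarrow> real"
    and f :: "real \<Rightarrow> real"
    and D :: "(real \<times> real) set"
    and \<phi> :: "nat \<Rightarrow> real \<times> real \<Rightarrow> complex"
    and lam :: "nat \<Rightarrow> real"
  assumes "0 < \<rho>" and "\<rho> < \<sigma>"
    and "0 < a 1"
    and "\<And>i. 1 \<le> i \<Longrightarrow> a (Suc i) = a i + real i powr \<rho>"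
    and "\<And>x. 0 < x \<Longrightarrow> 0 < f x"
    and "\<And>x. 0 < x \<Longrightarrow> continuous (at_right x) f"
    and "\<And>i x. 1 \<le> i \<Longrightarrow> x \<in> {a i..<a (Suc i)} \<Longrightarrow> f x = real i powr (- (1 + \<sigma>))"
    and "D = subgraph_domain f"
    and "open D" and "connected D"
    and "piecewise_smooth_boundary D"
    and "emeasure lborel D < \<infinity>"
    and "L2_orthonormal_basis D \<phi>"
    and "\<And>j. dirichlet_eigenfunction D (lam j) (\<phi> j)"
    and "0 < lam 0" and "mono lam" and "filterlim lam at_top sequentially"
  shows "\<exists>C>0.
     (\<exists>j :: nat \<Rightarrow> nat. strict_mono_on {1..} j \<and>
        (\<forall>i\<ge>1. lam (j i) \<in> spectral_window \<sigma> \<rho> C i) \<and>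
        (\<exists>c>0. \<forall>K. compact K \<longrightarrow> K \<subseteq> D \<longrightarrow>
           liminf (\<lambda>i. ereal (LINT p:D - K|lborel. (cmod (\<phi> (j i) p))\<^sup>2)) > ereal c))
     \<or> (\<forall>N :: nat. \<exists>\<^sub>F i in sequentially.
          N < card {j. lam j \<in> spectral_window \<sigma> \<rho> C i})"
proof (cases "\<forall>N :: nat. \<exists>\<^sub>F i in sequentially. N < card {j. lam j \<in> spectral_window \<sigma> \<rho> 180 i}")
  case True
  \<comment> \<open>Alternative (b) holds with the constant 180; otherwise the counts for 180 are
    eventually bounded and (a) is proved with a possibly larger constant.\<close>
  then show ?thesis by (intro exI[of _ 180]) simp
next
  case False
  define \<epsilon> where "\<epsilon> i = real i powr (- 2 * \<rho>)" for i
  define \<mu> where "\<mu> i = pi\<^sup>2 * real i powr (2 * (1 + \<sigma>))" for i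
  define \<delta> where "\<delta> i = real i powr (- (1 + \<sigma>))" for i
  \<comment> \<open>The midpoint. At the right end of the full interval \<open>f\<close> already has
    its next, smaller value, so a rectangle closed on that side would leave
    \<open>D\<close>.\<close>
  define b where "b i = a i + real i powr \<rho> / 2" for i
  define B where "B i = {a i..b i} \<times> {0<..<\<delta> i}" for i
  have \<sigma>: "0 < \<sigma>" using assms(1,2) by linarith
  from False obtain N i0 where count: "\<And>i. i0 \<le> i \<Longrightarrow> card {j. \<bar>lam j - \<mu> i\<bar> \<le> 180 * \<epsilon> i} \<le> N"
    by (auto simp: frequently_def eventually_sequentially not_less mem_spectral_window_iff \<mu>_def \<epsilon>_def)
  have step: "a (Suc i) = a i + real i powr \<rho>" "1 \<le> real i powr \<rho>" if "1 \<le> i" for i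
    using that assms(1,4) by (auto intro: ge_one_powr_ge_zero)
  have a_ge: "a 1 + real i - 1 \<le> a i" if "1 \<le> i" for i
    using that
  proof (induction i rule: dec_induct)
    case (step i)
    then show ?case using assms(4)[of i] ge_one_powr_ge_zero[of "real i" \<rho>] assms(1) by simp
  qed simp
  have a_pos: "0 < a i" if "1 \<le> i" for i
    using a_ge[OF that] assms(3) that by simp
  have ab: "a i < b i" "b i < a (Suc i)" if "1 \<le> i" for i
    using step[OF that] that by (auto simp: b_def)
  have f_eq: "f x = \<delta> i" "0 < x" if "1 \<le> i" "x \<in> {a i..b i}" for i x
    using assms(7)[of i x] ab[OF that(1)] a_pos[OF that(1)] that by (auto simp: \<delta>_def)
  have BD: "B i \<subseteq> D" if "1 \<le> i" for i
    using f_eq[OF that] by (auto simp: B_def assms(8) subgraph_domain_def)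
  have Bb: "B i \<in> sets lborel" for i
    by (simp add: B_def borel_Times)
  have disj: "disjoint_family_on B {1..}"
  proof (unfold disjoint_family_on_def, intro ballI impI)
    fix i k :: nat assume ik: "i \<in> {1..}" "k \<in> {1..}" "i \<noteq> k"
    have False if z: "z \<in> B i" "z \<in> B k" for z
    proof -
      \<comment> \<open>The heights are strictly decreasing, so the value of \<open>f\<close>
        identifies the rectangle.\<close>
      have "\<delta> i = \<delta> k" using f_eq(1)[of i "fst z"] f_eq(1)[of k "fst z"] z ik by (auto simp: B_def)
      then show False
        using ik \<sigma> powr_less_mono2_neg[of "- (1 + \<sigma>)" "real i" "real k"]
          powr_less_mono2_neg[of "- (1 + \<sigma>)" "real k" "real i"]
        by (cases i k rule: linorder_cases) (auto simp: \<delta>_def)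
    qed
    then show "B i \<inter> B k = {}" by blast
  qed
  have sq: "set_integrable lborel D (\<lambda>p. (cmod (\<phi> j p))\<^sup>2)" for j
    using assms(13) by (simp add: L2_orthonormal_basis_def L2_on_def)
  define weights where "weights i v \<longleftrightarrow> (\<forall>j. 0 \<le> v j) \<and> v sums 1 \<and>
      (\<forall>j. v j \<le> (LINT z:B i|lborel. (cmod (\<phi> j z))\<^sup>2)) \<and>
      (\<forall>n. (\<Sum>j<n. (lam j - \<mu> i)\<^sup>2 * v j) \<le> 8100 * (\<epsilon> i)\<^sup>2)" for i v
  have "\<exists>v. weights i v" if i: "1 \<le> i" for i
  proof -
    have \<delta>: "0 < \<delta> i" using i by (simp add: \<delta>_def)
    obtain w :: "nat \<Rightarrow> real" where w: "\<And>j. 0 \<le> w j" "w sums 1"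
      "\<And>j. w j \<le> (LINT z:B i|lborel. (cmod (\<phi> j z))\<^sup>2)"
      "\<And>n. (\<Sum>j<n. (lam j - (pi / \<delta> i)\<^sup>2)\<^sup>2 * w j) \<le> 504 / (b i - a i) ^ 4"
      using quasimode_spectral_weights[OF assms(9,13,14) ab(1)[OF i] \<delta>] BD[OF i] f_eq(1)[OF i]
      unfolding B_def by (auto simp: assms(8) subgraph_domain_def)
    have "(\<delta> i)\<^sup>2 = real i powr (- (2 * (1 + \<sigma>)))"
      by (simp add: \<delta>_def power2_eq_square flip: powr_add)
    then have \<mu>: "(pi / \<delta> i)\<^sup>2 = \<mu> i"
      unfolding power_divide \<mu>_def powr_minus by (simp add: divide_inverse)
    \<comment> \<open>Halving the length multiplies 504 by 16, and 8064 \<le> 8100.\<close>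
    have "504 / (b i - a i) ^ 4 \<le> 8100 * (\<epsilon> i)\<^sup>2"
    proof -
      have "(real i powr \<rho>) ^ 4 * (\<epsilon> i)\<^sup>2 = 1"
        using i by (simp add: \<epsilon>_def powr_power flip: powr_add)
      moreover have "0 < (real i powr \<rho>) ^ 4" using i by simp
      ultimately have "(\<epsilon> i)\<^sup>2 = 1 / (real i powr \<rho>) ^ 4"
        by (simp add: eq_divide_eq mult.commute)
      moreover have "504 / (b i - a i) ^ 4 = 8064 * (1 / (real i powr \<rho>) ^ 4)"
        by (simp add: b_def power_divide)
      moreover have "0 \<le> 1 / (real i powr \<rho>) ^ 4" by simp
      ultimately show ?thesis by linarith
    qed
    from order_trans[OF w(4) this] show ?thesis
      using w(1-3) unfolding \<mu> weights_def by blast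
  qed
  then obtain w where "\<And>i. 1 \<le> i \<Longrightarrow> weights i (w i)" by metis
  then have w: "\<And>i j. 1 \<le> i \<Longrightarrow> 0 \<le> w i j" "\<And>i. 1 \<le> i \<Longrightarrow> w i sums 1"
    "\<And>i j. 1 \<le> i \<Longrightarrow> w i j \<le> (LINT z:B i|lborel. (cmod (\<phi> j z))\<^sup>2)"
    "\<And>i n. 1 \<le> i \<Longrightarrow> (\<Sum>j<n. (lam j - \<mu> i)\<^sup>2 * w i j) \<le> 8100 * (\<epsilon> i)\<^sup>2"
    unfolding weights_def by blast+
  \<comment> \<open>The weights are bounded by the masses of one unit vector on disjoint subsets of
    \<open>D\<close>.\<close>
  have cap: "(\<Sum>i=1..n. w i j) \<le> 1" for n j
  proof -
    have "(\<Sum>i=1..n. w i j) \<le> (\<Sum>i=1..n. LINT z:B i|lborel. (cmod (\<phi> j z))\<^sup>2)"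
      by (intro sum_mono w) auto
    also have "\<dots> = (LINT z:(\<Union>i\<in>{1..n}. B i)|lborel. (cmod (\<phi> j z))\<^sup>2)"
      using disj Bb
      by (intro set_integral_finite_Union[symmetric] set_integrable_subset[OF sq] BD)
        (auto simp: disjoint_family_on_def)
    also have "\<dots> \<le> (LINT z:D|lborel. (cmod (\<phi> j z))\<^sup>2)"
      using Bb by (intro set_integral_mono_nonneg sq UN_least BD sets.finite_UN) auto
    finally show ?thesis by (simp add: L2_orthonormal_basis_unit[OF assms(13)])
  qed
  have gap: "\<mu> i + 18 * real i \<le> \<mu> (Suc i)" if "1 \<le> i" for i
  proof -
    \<comment> \<open>The 18 is twice 9, from pi > 3.\<close>
    have "9 * (2 * real i) \<le> pi\<^sup>2 * (2 * real i)"
      using power_mono[of 3 pi 2] pi_gt3 by (intro mult_right_mono) auto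
    also have "\<dots> \<le> \<mu> (Suc i) - \<mu> i"
      unfolding \<mu>_def right_diff_distrib[symmetric]
      using powr_Suc_gap[OF that \<sigma>] by (intro mult_left_mono) auto
    finally show ?thesis by simp
  qed
  have \<epsilon>1: "0 < \<epsilon> i" "\<epsilon> i \<le> 1" if "1 \<le> i" for i
    using that assms(1) by (auto simp: \<epsilon>_def powr_minus inverse_le_1_iff ge_one_powr_ge_zero)
  obtain C j c i1 where sel: "C > 0" "strict_mono_on {1..} j"
    "\<And>i. 1 \<le> i \<Longrightarrow> \<bar>lam (j i) - \<mu> i\<bar> \<le> C * \<epsilon> i"
    "c > 0" "\<And>i. i1 \<le> i \<Longrightarrow> c \<le> w i (j i)"
    by (rule quasimode_selection[OF assms(16,17) w(1,2,4) cap \<epsilon>1 gap count]) blast+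
  \<comment> \<open>The masses are eventually at least \<open>c\<close>, so the lower limit is at
    least \<open>c\<close>; halving yields the strict inequality with a constant independent of
    \<open>K\<close>.\<close>
  have "ereal (c / 2) < liminf (\<lambda>i. ereal (LINT p:D - K|lborel. (cmod (\<phi> (j i) p))\<^sup>2))"
    if K: "compact K" for K
  proof -
    obtain R where R: "\<And>z. z \<in> K \<Longrightarrow> norm z \<le> R"
      using compact_imp_bounded[OF K] by (auto simp: bounded_iff)
    obtain m :: nat where m: "R < real m" using reals_Archimedean2 by blast
    have "c \<le> (LINT p:D - K|lborel. (cmod (\<phi> (j i) p))\<^sup>2)" if i: "max (max 1 i1) (Suc m) \<le> i" for i
    proof -
      have "B i \<inter> K = {}"
      proof -
        \<comment> \<open>Every interval has length at least 1, so rectangle \<open>i\<close> starts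
          to the right of i - 1 \<ge> m > R.\<close>
        have "R < fst z" if "z \<in> B i" for z
          using that a_ge[of i] m i assms(3) by (auto simp: B_def)
        moreover have "fst z \<le> norm z" for z :: "real \<times> real"
          using norm_fst_le[of "fst z" "snd z"] by simp
        ultimately show ?thesis
          using R by (metis disjoint_iff linorder_not_less order_trans)
      qed
      then have "B i \<subseteq> D - K" using BD[of i] i by auto
      moreover have "D - K \<in> sets lborel"
        using assms(9) K by (simp add: compact_imp_closed borel_closed sets.Diff)
      ultimately have "(LINT p:B i|lborel. (cmod (\<phi> (j i) p))\<^sup>2) \<le> (LINT p:D - K|lborel. (cmod (\<phi> (j i) p))\<^sup>2)"
        by (intro set_integral_mono_nonneg set_integrable_subset[OF sq] Bb) auto
      then show ?thesis using sel(5)[of i] w(3)[of i "j i"] i by simp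
    qed
    then have "ereal c \<le> liminf (\<lambda>i. ereal (LINT p:D - K|lborel. (cmod (\<phi> (j i) p))\<^sup>2))"
      by (intro Liminf_bounded eventually_sequentiallyI[of "max (max 1 i1) (Suc m)"]) simp
    moreover have "ereal (c / 2) < ereal c" using sel(4) by simp
    ultimately show ?thesis by (rule less_le_trans[rotated])
  qed
  then have "\<exists>c>0. \<forall>K. compact K \<longrightarrow> K \<subseteq> D \<longrightarrow>
      liminf (\<lambda>i. ereal (LINT p:D - K|lborel. (cmod (\<phi> (j i) p))\<^sup>2)) > ereal c"
    using sel(4) by (intro exI[of _ "c / 2"]) auto
  moreover have "\<forall>i\<ge>1. lam (j i) \<in> spectral_window \<sigma> \<rho> C i"
    using sel(3) by (simp add: mem_spectral_window_iff \<mu>_def \<epsilon>_def)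
  ultimately show ?thesis using sel(1,2) by blast
qed

end
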